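(* Let $\perp$ be an invariant relation satisfying left and right monotonicity such that: (1) $\perp$ is weaker than $\perp^d$, i.e. $\perp^d\to\perp$; (2) $\perp$ satisfies $\perp^h$-amalgamation over models; (3) $\perp^m$ satisfies extension. Then $\perp^m=\perp^f=\perp^d$.
   Context: Work in a monster model of a complete first-order theory; $A,B,C,D$ denote small subsets (or tuples), $AB$ means $A\cup B$, and $A\equiv_C A'$ means equality of types over $C$. $\perp$ denotes a ternary relation $A\perp_C B$ on small subsets. It is invariant if $A\perp_C B$ and $ABC\equiv A'B'C'$ imply $A'\perp_{C'}B'$. Write $\perp^0\to\perp$ if $A\perp^0_C B$ implies $A\perp_C B$ for all $A,B,C$. Right monotonicity: $A\perp_C BD$ implies $A\perp_C B$. Left monotonicity: $AD\perp_C B$ implies $A\perp_C B$. Extension: if $A\perp_C B$ then for every small $D\supseteq B$ there is $A'\equiv_{BC}A$ with $A'\perp_C D$. $\perp^m$ is defined by: $A\perp^m_C B$ iff $A\perp_D B$ for all $D$ with $C\subseteq D\subseteq BC$. $A\perp^d_C B$ (resp. $A\perp^f_C B$) means that $\mathrm{tp}(A/BC)$ does not divide (resp. fork) over $C$. $A\perp^h_C B$ means that $\mathrm{tp}(A/BC)$ is a coheir of $\mathrm{tp}(A/C)$, i.e. is finitely satisfiable in $C$. $\perp$ satisfies $\perp^h$-amalgamation over models if for every small model $M$ and small tuples $a,b,c_1,c_2$: if $c_1\equiv_M c_2$, $c_1\perp_M a$, $c_2\perp_M b$ and $a\perp^h_M b$, then there is $c$ with $c\perp_M ab$, $c\equiv_{Ma}c_1$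 and $c\equiv_{Mb}c_2$. *)

theory Defs
  imports Main
begin

unbundle cardinal_syntax

section \<open>First-order logic\<close>

text \<open>
  A symbol of the language is a name together with its arity, so the same name may occur with
  several arities. An $L(A)$-formula is a formula whose parameters \<open>Par a\<close> (constants naming
  elements of the structure) satisfy \<open>a \<in> A\<close>; an $L$-formula has no parameters.
\<close>

record ('f, 'r) lang =
  Funs :: "('f \<times> nat) set"
  Rels :: "('r \<times> nat) set"

datatype (dead 'f, pars_tm: 'm) tm =
    Var nat
  | Par 'm
  | App 'f "('f, 'm) tm list"
  for map: inst_tm

datatype (dead 'f, dead 'r, pars_fm: 'm) fm =
    Eq "('f, 'm) tm" "('f, 'm) tm"
  | Atom 'r "('f, 'm) tm list"
  | Neg "('f, 'r, 'm) fm"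
  | Conj "('f, 'r, 'm) fm" "('f, 'r, 'm) fm"
  | Ex nat "('f, 'r, 'm) fm"
  for map: inst_fm

primrec fv_tm :: "('f, 'm) tm \<Rightarrow> nat set" where
  "fv_tm (Var x) = {x}"
| "fv_tm (Par a) = {}"
| "fv_tm (App f ts) = \<Union> (set (map fv_tm ts))"

primrec fv :: "('f, 'r, 'm) fm \<Rightarrow> nat set" where
  "fv (Eq s t) = fv_tm s \<union> fv_tm t"
| "fv (Atom r ts) = \<Union> (set (map fv_tm ts))"
| "fv (Neg \<phi>) = fv \<phi>"
| "fv (Conj \<phi> \<psi>) = fv \<phi> \<union> fv \<psi>"
| "fv (Ex x \<phi>) = fv \<phi> - {x}"

primrec wf_tm :: "('f, 'r) lang \<Rightarrow> ('f, 'm) tm \<Rightarrow> bool" where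
  "wf_tm L (Var x) \<longleftrightarrow> True"
| "wf_tm L (Par a) \<longleftrightarrow> True"
| "wf_tm L (App f ts) \<longleftrightarrow> (f, length ts) \<in> Funs L \<and> list_all (wf_tm L) ts"

primrec wf_fm :: "('f, 'r) lang \<Rightarrow> ('f, 'r, 'm) fm \<Rightarrow> bool" where
  "wf_fm L (Eq s t) \<longleftrightarrow> wf_tm L s \<and> wf_tm L t"
| "wf_fm L (Atom r ts) \<longleftrightarrow> (r, length ts) \<in> Rels L \<and> list_all (wf_tm L) ts"
| "wf_fm L (Neg \<phi>) \<longleftrightarrow> wf_fm L \<phi>"
| "wf_fm L (Conj \<phi> \<psi>) \<longleftrightarrow> wf_fm L \<phi> \<and> wf_fm L \<psi>"
| "wf_fm L (Ex x \<phi>) \<longleftrightarrow> wf_fm L \<phi>"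

definition formulas :: "('f, 'r) lang \<Rightarrow> 'm set \<Rightarrow> ('f, 'r, 'm) fm set" where
  "formulas L A = {\<phi>. wf_fm L \<phi> \<and> pars_fm \<phi> \<subseteq> A}"

text \<open>
  Structures are carried by a whole type; the argument \<open>U\<close> of \<open>sat\<close> is the range of the
  quantifiers, so that substructures are subsets of the type.
\<close>

record ('f, 'r, 'm) struct =
  fun_of :: "'f \<Rightarrow> 'm list \<Rightarrow> 'm"
  rel_of :: "'r \<Rightarrow> 'm list \<Rightarrow> bool"

primrec eval_tm :: "('f, 'r, 'm) struct \<Rightarrow> (nat \<Rightarrow> 'm) \<Rightarrow> ('f, 'm) tm \<Rightarrow> 'm" where
  "eval_tm M e (Var x) = e x"
| "eval_tm M e (Par a) = a"
| "eval_tm M e (App f ts) = fun_of M f (map (eval_tm M e) ts)"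

primrec sat :: "'m set \<Rightarrow> ('f, 'r, 'm) struct \<Rightarrow> (nat \<Rightarrow> 'm) \<Rightarrow> ('f, 'r, 'm) fm \<Rightarrow> bool" where
  "sat U M e (Eq s t) \<longleftrightarrow> eval_tm M e s = eval_tm M e t"
| "sat U M e (Atom r ts) \<longleftrightarrow> rel_of M r (map (eval_tm M e) ts)"
| "sat U M e (Neg \<phi>) \<longleftrightarrow> \<not> sat U M e \<phi>"
| "sat U M e (Conj \<phi> \<psi>) \<longleftrightarrow> sat U M e \<phi> \<and> sat U M e \<psi>"
| "sat U M e (Ex x \<phi>) \<longleftrightarrow> (\<exists>a\<in>U. sat U M (e(x := a)) \<phi>)"

abbreviation holds :: "('f, 'r, 'm) struct \<Rightarrow> (nat \<Rightarrow> 'm) \<Rightarrow> ('f, 'r, 'm) fm \<Rightarrow> bool" where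
  "holds M \<equiv> sat UNIV M"

definition sentences :: "('f, 'r) lang \<Rightarrow> ('f, 'r, 'm) fm set" where
  "sentences L = {\<phi> \<in> formulas L {}. fv \<phi> = {}}"

text \<open>Theories are taken up to deductive closure.\<close>

definition complete_theory :: "('f, 'r) lang \<Rightarrow> ('f, 'r, 'm) fm set \<Rightarrow> bool" where
  "complete_theory L T \<longleftrightarrow>
     T \<subseteq> sentences L \<and> (\<forall>\<phi>\<in>sentences L. \<phi> \<in> T \<or> Neg \<phi> \<in> T)"

definition is_model :: "('f, 'r, 'm) struct \<Rightarrow> ('f, 'r, 'm) fm set \<Rightarrow> bool" where
  "is_model M T \<longleftrightarrow> (\<forall>\<phi>\<in>T. \<forall>e. holds M e \<phi>)"


section \<open>Types\<close>

text \<open>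
  A tuple is a function \<open>a\<close> considered on an index set \<open>I\<close>, with variables $(x_i)_{i \in I}$.
  The pair \<open>(\<phi>, \<sigma>)\<close> stands for the formula obtained from \<open>\<phi>\<close> by
  replacing its $n$-th free variable by $x_{\sigma(n)}$, and \<open>tp L M I a B\<close> is
  $\mathrm{tp}((a_i)_{i \in I} / B)$. A set \<open>A\<close> is enumerated by itself: \<open>tp L M A id B\<close>.
\<close>

definition tp :: "('f, 'r) lang \<Rightarrow> ('f, 'r, 'm) struct \<Rightarrow> 'i set \<Rightarrow> ('i \<Rightarrow> 'm) \<Rightarrow> 'm set
    \<Rightarrow> (('f, 'r, 'm) fm \<times> (nat \<Rightarrow> 'i)) set" where
  "tp L M I a B =
     {(\<phi>, \<sigma>). \<phi> \<in> formulas L B \<and> \<sigma> ` fv \<phi> \<subseteq> I \<and> holds M (a \<circ> \<sigma>) \<phi>}"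

text \<open>
  For sets, \<open>A' \<equiv>\<^sub>C A\<close> and \<open>ABC \<equiv> A'B'C'\<close> mean that the primed
  sets have enumerations, indexed by the unprimed ones, of the same type.
\<close>

definition set_equiv :: "('f, 'r) lang \<Rightarrow> ('f, 'r, 'm) struct \<Rightarrow> 'm set \<Rightarrow> 'm set \<Rightarrow> 'm set \<Rightarrow> bool" where
  "set_equiv L M C A' A \<longleftrightarrow> (\<exists>g. g ` A = A' \<and> tp L M A g C = tp L M A id C)"

definition triple_equiv :: "('f, 'r) lang \<Rightarrow> ('f, 'r, 'm) struct
    \<Rightarrow> 'm set \<Rightarrow> 'm set \<Rightarrow> 'm set \<Rightarrow> 'm set \<Rightarrow> 'm set \<Rightarrow> 'm set \<Rightarrow> bool" where
  "triple_equiv L M A B C A' B' C' \<longleftrightarrow>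
     (\<exists>g. g ` A = A' \<and> g ` B = B' \<and> g ` C = C' \<and>
          tp L M (A \<union> B \<union> C) g {} = tp L M (A \<union> B \<union> C) id {})"


section \<open>Monster models\<close>

definition small :: "'k rel \<Rightarrow> 'a set \<Rightarrow> bool" where
  "small \<kappa> A \<longleftrightarrow> |A| <o \<kappa>"

definition saturated :: "('f, 'r) lang \<Rightarrow> ('f, 'r, 'm) struct \<Rightarrow> 'k rel \<Rightarrow> bool" where
  "saturated L M \<kappa> \<longleftrightarrow>
     (\<forall>A p. small \<kappa> A \<longrightarrow> p \<subseteq> {\<phi> \<in> formulas L A. fv \<phi> \<subseteq> {0}} \<longrightarrow>
        (\<forall>q. q \<subseteq> p \<longrightarrow> finite q \<longrightarrow> (\<exists>a. \<forall>\<phi>\<in>q. holds M (\<lambda>_. a) \<phi>)) \<longrightarrow>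
        (\<exists>a. \<forall>\<phi>\<in>p. holds M (\<lambda>_. a) \<phi>))"

definition automorphism :: "('f, 'r) lang \<Rightarrow> ('f, 'r, 'm) struct \<Rightarrow> ('m \<Rightarrow> 'm) \<Rightarrow> bool" where
  "automorphism L M h \<longleftrightarrow> bij h \<and>
     (\<forall>(f, n)\<in>Funs L. \<forall>xs. length xs = n \<longrightarrow> h (fun_of M f xs) = fun_of M f (map h xs)) \<and>
     (\<forall>(r, n)\<in>Rels L. \<forall>xs. length xs = n \<longrightarrow> rel_of M r xs = rel_of M r (map h xs))"

definition strongly_homogeneous :: "('f, 'r) lang \<Rightarrow> ('f, 'r, 'm) struct \<Rightarrow> 'k rel \<Rightarrow> bool" where
  "strongly_homogeneous L M \<kappa> \<longleftrightarrow>
     (\<forall>A g. small \<kappa> A \<longrightarrow> tp L M A g {} = tp L M A id {} \<longrightarrow>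
        (\<exists>h. automorphism L M h \<and> (\<forall>a\<in>A. h a = g a)))"

text \<open>The only largeness required of \<open>\<kappa>\<close> is $\kappa > |L| + \aleph_0$.\<close>

definition monster_model :: "('f, 'r) lang \<Rightarrow> ('f, 'r, 'm) fm set \<Rightarrow> ('f, 'r, 'm) struct \<Rightarrow> 'k rel \<Rightarrow> bool" where
  "monster_model L T M \<kappa> \<longleftrightarrow>
     complete_theory L T \<and> is_model M T \<and>
     Card_order \<kappa> \<and> natLeq <o \<kappa> \<and> |Funs L| <o \<kappa> \<and> |Rels L| <o \<kappa> \<and>
     saturated L M \<kappa> \<and> strongly_homogeneous L M \<kappa>"

definition small_model :: "('f, 'r) lang \<Rightarrow> ('f, 'r, 'm) struct \<Rightarrow> 'k rel \<Rightarrow> 'm set \<Rightarrow> bool" where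
  "small_model L M \<kappa> N \<longleftrightarrow> small \<kappa> N \<and> N \<noteq> {} \<and>
     (\<forall>(f, n)\<in>Funs L. \<forall>xs. length xs = n \<longrightarrow> set xs \<subseteq> N \<longrightarrow> fun_of M f xs \<in> N) \<and>
     (\<forall>\<phi>\<in>formulas L {}. \<forall>e. range e \<subseteq> N \<longrightarrow> sat N M e \<phi> = holds M e \<phi>)"


section \<open>Dividing, forking and coheirs\<close>

text \<open>
  The formula \<open>\<phi>\<close> below is $\varphi(x, b)$ with \<open>b\<close> its tuple of parameters (indexed by itself);
  \<open>\<beta> i\<close> is the tuple $b_i$ and \<open>inst_fm (\<beta> i) \<phi>\<close> is $\varphi(x, b_i)$.
\<close>

definition formula_divides :: "('f, 'r) lang \<Rightarrow> ('f, 'r, 'm) struct \<Rightarrow> 'm set \<Rightarrow> ('f, 'r, 'm) fm \<Rightarrow> bool" where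
  "formula_divides L M C \<phi> \<longleftrightarrow>
     (\<exists>k (\<beta> :: nat \<Rightarrow> 'm \<Rightarrow> 'm).
        (\<forall>i. tp L M (pars_fm \<phi>) (\<beta> i) C = tp L M (pars_fm \<phi>) id C) \<and>
        (\<forall>S. finite S \<and> card S = k \<longrightarrow> \<not> (\<exists>e. \<forall>i\<in>S. holds M e (inst_fm (\<beta> i) \<phi>))))"

definition formula_forks :: "('f, 'r) lang \<Rightarrow> ('f, 'r, 'm) struct \<Rightarrow> 'm set \<Rightarrow> ('f, 'r, 'm) fm \<Rightarrow> bool" where
  "formula_forks L M C \<phi> \<longleftrightarrow>
     (\<exists>\<Psi>. finite \<Psi> \<and> \<Psi> \<subseteq> {\<psi> \<in> formulas L UNIV. fv \<psi> \<subseteq> fv \<phi>} \<and>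
        (\<forall>\<psi>\<in>\<Psi>. formula_divides L M C \<psi>) \<and>
        (\<forall>e. holds M e \<phi> \<longrightarrow> (\<exists>\<psi>\<in>\<Psi>. holds M e \<psi>)))"

text \<open>
  A complete type divides (forks) over \<open>C\<close> if it contains a formula that does. In all relations
  below the base is the second argument: \<open>R A C B\<close> is $A \perp_C B$.
\<close>

type_synonym 'm indep = "'m set \<Rightarrow> 'm set \<Rightarrow> 'm set \<Rightarrow> bool"

definition indep_d :: "('f, 'r) lang \<Rightarrow> ('f, 'r, 'm) struct \<Rightarrow> 'm indep" where
  "indep_d L M A C B \<longleftrightarrow> \<not> (\<exists>(\<phi>, \<sigma>)\<in>tp L M A id (B \<union> C). formula_divides L M C \<phi>)"

definition indep_f :: "('f, 'r) lang \<Rightarrow> ('f, 'r, 'm) struct \<Rightarrow> 'm indep" where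
  "indep_f L M A C B \<longleftrightarrow> \<not> (\<exists>(\<phi>, \<sigma>)\<in>tp L M A id (B \<union> C). formula_forks L M C \<phi>)"

text \<open>
  As a complete type is closed under conjunction, finite satisfiability need only be tested on
  single formulas.
\<close>

definition indep_h :: "('f, 'r) lang \<Rightarrow> ('f, 'r, 'm) struct \<Rightarrow> 'm indep" where
  "indep_h L M A C B \<longleftrightarrow>
     (\<forall>(\<phi>, \<sigma>)\<in>tp L M A id (B \<union> C). \<exists>g. g ` A \<subseteq> C \<and> holds M (g \<circ> \<sigma>) \<phi>)"


section \<open>Properties of abstract relations on small sets\<close>

definition monotonise :: "'m indep \<Rightarrow> 'm indep" where
  "monotonise R A C B \<longleftrightarrow> (\<forall>D. C \<subseteq> D \<and> D \<subseteq> B \<union> C \<longrightarrow> R A D B)"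

definition stronger :: "'k rel \<Rightarrow> 'm indep \<Rightarrow> 'm indep \<Rightarrow> bool" where
  "stronger \<kappa> R0 R \<longleftrightarrow>
     (\<forall>A B C. small \<kappa> A \<and> small \<kappa> B \<and> small \<kappa> C \<and> R0 A C B \<longrightarrow> R A C B)"

definition same_indep :: "'k rel \<Rightarrow> 'm indep \<Rightarrow> 'm indep \<Rightarrow> bool" where
  "same_indep \<kappa> R0 R \<longleftrightarrow>
     (\<forall>A B C. small \<kappa> A \<and> small \<kappa> B \<and> small \<kappa> C \<longrightarrow> R0 A C B = R A C B)"

definition invariant :: "('f, 'r) lang \<Rightarrow> ('f, 'r, 'm) struct \<Rightarrow> 'k rel \<Rightarrow> 'm indep \<Rightarrow> bool" where
  "invariant L M \<kappa> R \<longleftrightarrow>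
     (\<forall>A B C A' B' C'. small \<kappa> A \<and> small \<kappa> B \<and> small \<kappa> C \<and>
        R A C B \<and> triple_equiv L M A B C A' B' C' \<longrightarrow> R A' C' B')"

definition right_monotone :: "'k rel \<Rightarrow> 'm indep \<Rightarrow> bool" where
  "right_monotone \<kappa> R \<longleftrightarrow>
     (\<forall>A B C D. small \<kappa> A \<and> small \<kappa> B \<and> small \<kappa> C \<and> small \<kappa> D \<and>
        R A C (B \<union> D) \<longrightarrow> R A C B)"

definition left_monotone :: "'k rel \<Rightarrow> 'm indep \<Rightarrow> bool" where
  "left_monotone \<kappa> R \<longleftrightarrow>
     (\<forall>A B C D. small \<kappa> A \<and> small \<kappa> B \<and> small \<kappa> C \<and> small \<kappa> D \<and>
        R (A \<union> D) C B \<longrightarrow> R A C B)"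

definition has_extension :: "('f, 'r) lang \<Rightarrow> ('f, 'r, 'm) struct \<Rightarrow> 'k rel \<Rightarrow> 'm indep \<Rightarrow> bool" where
  "has_extension L M \<kappa> R \<longleftrightarrow>
     (\<forall>A B C D. small \<kappa> A \<and> small \<kappa> B \<and> small \<kappa> C \<and> small \<kappa> D \<and> B \<subseteq> D \<and> R A C B \<longrightarrow>
        (\<exists>A'. set_equiv L M (B \<union> C) A' A \<and> R A' C D))"

text \<open>
  The tuples \<open>c1\<close>, \<open>c2\<close>, \<open>c\<close> are indexed by a small set \<open>I\<close> of elements of the type
  underlying \<open>\<kappa>\<close>; this covers all small index sets up to bijection. Only the ranges of the
  tuples \<open>a\<close>, \<open>b\<close> matter, and these are the sets \<open>A\<close>, \<open>B\<close>.
\<close>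

definition h_amalgamation_over_models ::
    "('f, 'r) lang \<Rightarrow> ('f, 'r, 'm) struct \<Rightarrow> 'k rel \<Rightarrow> 'm indep \<Rightarrow> bool" where
  "h_amalgamation_over_models L M \<kappa> R \<longleftrightarrow>
     (\<forall>N A B (I :: 'k set) c1 c2.
        small_model L M \<kappa> N \<and> small \<kappa> A \<and> small \<kappa> B \<and> small \<kappa> I \<and>
        tp L M I c1 N = tp L M I c2 N \<and>
        R (c1 ` I) N A \<and> R (c2 ` I) N B \<and> indep_h L M A N B \<longrightarrow>
        (\<exists>c. R (c ` I) N (A \<union> B) \<and>
             tp L M I c (N \<union> A) = tp L M I c1 (N \<union> A) \<and>
             tp L M I c (N \<union> B) = tp L M I c2 (N \<union> B)))"

end

theory Submission
  imports Defs
begin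

text \<open>
  Non-dividing implies the monotonisation of any weaker relation, because it is preserved when the
  base grows inside \<open>BC\<close>; and extension turns "does not divide" into "does not fork".
  The point is therefore that the monotonised relation implies non-dividing. Let
  $\varphi(x, b) \in \mathrm{tp}(A/BC)$ divide over \<open>C\<close>, witnessed by $(b_i)$. The limit of
  the types of the $b_i$ along a nonprincipal ultrafilter is finitely satisfiable in any model that
  contains \<open>C\<close> and all $b_i$. After moving this model to some \<open>N\<close> by an automorphism over
  \<open>C\<close>, its Morley sequence over \<open>N\<close> starts with \<open>b\<close>, and the conjugates of
  \<open>\<phi>\<close> along it are still \<open>k\<close>-inconsistent. By extension \<open>A\<close> may be taken independent
  from \<open>BN\<close> over \<open>C\<close> in the monotonised sense, hence from \<open>b\<close> over \<open>N\<close>, and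
  coheir amalgamation then solves \<open>k\<close> of these conjugates simultaneously.
\<close>

section \<open>Substitution\<close>

primrec tr_tm :: "(nat \<Rightarrow> ('f, 'm) tm) \<Rightarrow> ('m \<Rightarrow> ('f, 'm) tm) \<Rightarrow> ('f, 'm) tm \<Rightarrow> ('f, 'm) tm" where
  "tr_tm \<theta> \<rho> (Var x) = \<theta> x"
| "tr_tm \<theta> \<rho> (Par a) = \<rho> a"
| "tr_tm \<theta> \<rho> (App f ts) = App f (map (tr_tm \<theta> \<rho>) ts)"

text \<open>
  \<open>tr_fm s \<theta> \<rho>\<close> substitutes for free variables and for parameters. Bound variables are
  renamed by \<open>s\<close>, whose range should avoid the variables of the substituted terms.
\<close>

primrec tr_fm :: "(nat \<Rightarrow> nat) \<Rightarrow> (nat \<Rightarrow> ('f, 'm) tm) \<Rightarrow> ('m \<Rightarrow> ('f, 'm) tm)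
    \<Rightarrow> ('f, 'r, 'm) fm \<Rightarrow> ('f, 'r, 'm) fm" where
  "tr_fm s \<theta> \<rho> (Eq t u) = Eq (tr_tm \<theta> \<rho> t) (tr_tm \<theta> \<rho> u)"
| "tr_fm s \<theta> \<rho> (Atom r ts) = Atom r (map (tr_tm \<theta> \<rho>) ts)"
| "tr_fm s \<theta> \<rho> (Neg \<phi>) = Neg (tr_fm s \<theta> \<rho> \<phi>)"
| "tr_fm s \<theta> \<rho> (Conj \<phi> \<psi>) = Conj (tr_fm s \<theta> \<rho> \<phi>) (tr_fm s \<theta> \<rho> \<psi>)"
| "tr_fm s \<theta> \<rho> (Ex x \<phi>) = Ex (s x) (tr_fm s (\<theta>(x := Var (s x))) \<rho> \<phi>)"

lemma eval_tm_cong: "(\<And>x. x \<in> fv_tm t \<Longrightarrow> e x = e' x) \<Longrightarrow> eval_tm M e t = eval_tm M e' t"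
proof (induction t)
  case (App f ts)
  have "eval_tm M e t = eval_tm M e' t" if "t \<in> set ts" for t
    by (rule App.IH) (use App.prems that in auto)
  then have "map (eval_tm M e) ts = map (eval_tm M e') ts" by simp
  then show ?case by (simp del: map_eq_conv)
qed auto

lemma sat_cong: "(\<And>x. x \<in> fv \<phi> \<Longrightarrow> e x = e' x) \<Longrightarrow> sat U M e \<phi> = sat U M e' \<phi>"
proof (induction \<phi> arbitrary: e e')
  case (Eq s t)
  then show ?case by (simp add: eval_tm_cong[of s e e'] eval_tm_cong[of t e e'])
next
  case (Atom r ts)
  have "eval_tm M e t = eval_tm M e' t" if "t \<in> set ts" for t
    by (rule eval_tm_cong) (use Atom that in auto)
  then have "map (eval_tm M e) ts = map (eval_tm M e') ts" by simp
  then show ?case by (simp del: map_eq_conv)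
next
  case (Conj \<phi> \<psi>)
  have "sat U M e \<phi> = sat U M e' \<phi>" "sat U M e \<psi> = sat U M e' \<psi>"
    by (rule Conj.IH(1), use Conj.prems in simp) (rule Conj.IH(2), use Conj.prems in simp)
  then show ?case by simp
next
  case (Ex x \<phi>)
  have "sat U M (e(x := a)) \<phi> = sat U M (e'(x := a)) \<phi>" for a
    by (rule Ex.IH) (use Ex.prems in auto)
  then show ?case by simp
next
  case (Neg \<phi>)
  have "sat U M e \<phi> = sat U M e' \<phi>" by (rule Neg.IH) (use Neg.prems in auto)
  then show ?case by simp
qed

lemma finite_fv_tm: "finite (fv_tm t)"
  by (induction t) auto

lemma finite_fv: "finite (fv \<phi>)"
  by (induction \<phi>) (auto simp: finite_fv_tm)

lemma finite_pars_tm: "finite (pars_tm t)"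
  by (induction t) auto

lemma finite_pars_fm: "finite (pars_fm \<phi>)"
  by (induction \<phi>) (auto simp: finite_pars_tm)

lemma fv_tr_tm: "fv_tm (tr_tm \<theta> \<rho> t) \<subseteq> (\<Union>y\<in>fv_tm t. fv_tm (\<theta> y)) \<union> (\<Union>a\<in>pars_tm t. fv_tm (\<rho> a))"
  by (induction t) (auto, blast)

lemma fv_tr_fm: "fv (tr_fm s \<theta> \<rho> \<phi>) \<subseteq> (\<Union>y\<in>fv \<phi>. fv_tm (\<theta> y)) \<union> (\<Union>a\<in>pars_fm \<phi>. fv_tm (\<rho> a))"
proof (induction \<phi> arbitrary: \<theta>)
  case (Eq t u)
  then show ?case using fv_tr_tm[of \<theta> \<rho> t] fv_tr_tm[of \<theta> \<rho> u] by auto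
next
  case (Atom r ts)
  then show ?case using fv_tr_tm[of \<theta> \<rho>] by fastforce
next
  case (Ex x \<phi>)
  show ?case
  proof
    fix v assume v: "v \<in> fv (tr_fm s \<theta> \<rho> (Ex x \<phi>))"
    then have "v \<in> fv (tr_fm s (\<theta>(x := Var (s x))) \<rho> \<phi>)" by simp
    with Ex.IH have "(\<exists>y\<in>fv \<phi>. v \<in> fv_tm ((\<theta>(x := Var (s x))) y)) \<or> (\<exists>a\<in>pars_fm \<phi>. v \<in> fv_tm (\<rho> a))"
      by blast
    then show "v \<in> (\<Union>y\<in>fv (Ex x \<phi>). fv_tm (\<theta> y)) \<union> (\<Union>a\<in>pars_fm (Ex x \<phi>). fv_tm (\<rho> a))"
    proof
      assume "\<exists>y\<in>fv \<phi>. v \<in> fv_tm ((\<theta>(x := Var (s x))) y)"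
      then obtain y where "y \<in> fv \<phi>" "v \<in> fv_tm ((\<theta>(x := Var (s x))) y)" by blast
      then show ?thesis using v by (cases "y = x") auto
    qed auto
  qed
next
  case (Neg \<phi>)
  then show ?case by simp
next
  case (Conj \<phi> \<psi>)
  show ?case using Conj.IH[of \<theta>] by auto
qed

lemma pars_tr_tm:
  "pars_tm (tr_tm \<theta> \<rho> t) \<subseteq> (\<Union>y\<in>fv_tm t. pars_tm (\<theta> y)) \<union> (\<Union>a\<in>pars_tm t. pars_tm (\<rho> a))"
  by (induction t) (auto, blast)

lemma pars_tr_fm:
  "pars_fm (tr_fm s \<theta> \<rho> \<phi>) \<subseteq> (\<Union>y\<in>fv \<phi>. pars_tm (\<theta> y)) \<union> (\<Union>a\<in>pars_fm \<phi>. pars_tm (\<rho> a))"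
proof (induction \<phi> arbitrary: \<theta>)
  case (Eq t u)
  then show ?case using pars_tr_tm[of \<theta> \<rho> t] pars_tr_tm[of \<theta> \<rho> u] by auto
next
  case (Atom r ts)
  then show ?case using pars_tr_tm[of \<theta> \<rho>] by fastforce
next
  case (Ex x \<phi>)
  show ?case
  proof
    fix v assume v: "v \<in> pars_fm (tr_fm s \<theta> \<rho> (Ex x \<phi>))"
    then have "v \<in> pars_fm (tr_fm s (\<theta>(x := Var (s x))) \<rho> \<phi>)" by simp
    with Ex.IH have "(\<exists>y\<in>fv \<phi>. v \<in> pars_tm ((\<theta>(x := Var (s x))) y)) \<or> (\<exists>a\<in>pars_fm \<phi>. v \<in> pars_tm (\<rho> a))"
      by blast
    then show "v \<in> (\<Union>y\<in>fv (Ex x \<phi>). pars_tm (\<theta> y)) \<union> (\<Union>a\<in>pars_fm (Ex x \<phi>). pars_tm (\<rho> a))"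
    proof
      assume "\<exists>y\<in>fv \<phi>. v \<in> pars_tm ((\<theta>(x := Var (s x))) y)"
      then obtain y where "y \<in> fv \<phi>" "v \<in> pars_tm ((\<theta>(x := Var (s x))) y)" by blast
      then show ?thesis using v by (cases "y = x") auto
    qed auto
  qed
next
  case (Neg \<phi>)
  then show ?case by simp
next
  case (Conj \<phi> \<psi>)
  show ?case using Conj.IH[of \<theta>] by auto
qed

lemma wf_tr_tm: "wf_tm L t \<Longrightarrow> (\<And>y. wf_tm L (\<theta> y)) \<Longrightarrow> (\<And>a. wf_tm L (\<rho> a)) \<Longrightarrow> wf_tm L (tr_tm \<theta> \<rho> t)"
  by (induction t) (auto simp: list_all_iff)

lemma wf_tr_fm: "wf_fm L \<phi> \<Longrightarrow> (\<And>y. wf_tm L (\<theta> y)) \<Longrightarrow> (\<And>a. wf_tm L (\<rho> a)) \<Longrightarrow> wf_fm L (tr_fm s \<theta> \<rho> \<phi>)"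
  by (induction \<phi> arbitrary: \<theta>) (auto simp: list_all_iff wf_tr_tm)

lemma eval_tr_tm:
  "eval_tm M e (tr_tm \<theta> \<rho> t) = eval_tm M (\<lambda>y. eval_tm M e (\<theta> y)) (inst_tm (\<lambda>a. eval_tm M e (\<rho> a)) t)"
  by (induction t) (auto simp: comp_def intro!: arg_cong[where f = "fun_of M _"])

lemma sat_tr_fm:
  assumes "inj s" "\<And>x a. s x \<notin> fv_tm (\<rho> a)" "\<And>x y. s x \<in> fv_tm (\<theta> y) \<Longrightarrow> \<theta> y = Var (s y)"
  shows "sat U M e (tr_fm s \<theta> \<rho> \<phi>) =
    sat U M (\<lambda>y. eval_tm M e (\<theta> y)) (inst_fm (\<lambda>a. eval_tm M e (\<rho> a)) \<phi>)"
  using assms(3)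
proof (induction \<phi> arbitrary: \<theta> e)
  case (Atom r ts)
  then show ?case by (simp add: comp_def eval_tr_tm)
next
  case (Ex x \<phi>)
  have "sat U M (e(s x := a)) (tr_fm s (\<theta>(x := Var (s x))) \<rho> \<phi>) =
      sat U M ((\<lambda>y. eval_tm M e (\<theta> y))(x := a)) (inst_fm (\<lambda>a. eval_tm M e (\<rho> a)) \<phi>)" for a
  proof -
    have "sat U M (e(s x := a)) (tr_fm s (\<theta>(x := Var (s x))) \<rho> \<phi>) =
       sat U M (\<lambda>y. eval_tm M (e(s x := a)) ((\<theta>(x := Var (s x))) y))
         (inst_fm (\<lambda>b. eval_tm M (e(s x := a)) (\<rho> b)) \<phi>)"
      by (rule Ex.IH) (use Ex.prems in \<open>auto split: if_splits\<close>)
    moreover have "(\<lambda>b. eval_tm M (e(s x := a)) (\<rho> b)) = (\<lambda>b. eval_tm M e (\<rho> b))"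
      using assms(2) by (metis eval_tm_cong fun_upd_other)
    moreover have "eval_tm M (e(s x := a)) (\<theta> y) = eval_tm M e (\<theta> y)" if "y \<noteq> x" for y
    proof (cases "s x \<in> fv_tm (\<theta> y)")
      case True
      then show ?thesis using Ex.prems[of x y] that \<open>inj s\<close> by (auto simp: inj_eq)
    next
      case False
      then show ?thesis by (intro eval_tm_cong) auto
    qed
    then have "(\<lambda>y. eval_tm M (e(s x := a)) ((\<theta>(x := Var (s x))) y)) = (\<lambda>y. eval_tm M e (\<theta> y))(x := a)"
      by auto
    ultimately show ?thesis by simp
  qed
  then show ?case by simp
qed (auto simp: eval_tr_tm)

lemma inst_fm_id: "inst_fm (\<lambda>a. a) \<phi> = \<phi>"
  using fm.map_id[of \<phi>] by (simp add: id_def)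

lemma inst_fm_inst_fm: "inst_fm f (inst_fm g \<phi>) = inst_fm (\<lambda>a. f (g a)) \<phi>"
  by (simp add: fm.map_comp comp_def)

lemma fv_inst_tm: "fv_tm (inst_tm g t) = fv_tm t"
  by (induction t) auto

lemma fv_inst_fm: "fv (inst_fm g \<phi>) = fv \<phi>"
  by (induction \<phi>) (auto simp: fv_inst_tm)

lemma wf_inst_tm: "wf_tm L (inst_tm g t) = wf_tm L t"
  by (induction t) (auto simp: list_all_iff)

lemma wf_inst_fm: "wf_fm L (inst_fm g \<phi>) = wf_fm L \<phi>"
  by (induction \<phi>) (auto simp: list_all_iff wf_inst_tm)

lemma inst_fm_in_formulas: "\<phi> \<in> formulas L X \<Longrightarrow> g ` pars_fm \<phi> \<subseteq> Y \<Longrightarrow> inst_fm g \<phi> \<in> formulas L Y"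
  by (auto simp: formulas_def wf_inst_fm fm.set_map)

lemma formulas_mono: "X \<subseteq> Y \<Longrightarrow> formulas L X \<subseteq> formulas L Y"
  by (auto simp: formulas_def)

lemma ex_finite_conj:
  assumes "finite \<Psi>" "\<Psi> \<subseteq> formulas L X"
  shows "\<exists>\<chi>\<in>formulas L X. fv \<chi> \<subseteq> insert 0 (\<Union> (fv ` \<Psi>)) \<and>
    (\<forall>U M e. sat U M e \<chi> \<longleftrightarrow> (\<forall>\<psi>\<in>\<Psi>. sat U M e \<psi>))"
  using assms
proof (induction \<Psi> rule: finite_induct)
  case empty
  show ?case by (rule bexI[of _ "Eq (Var 0) (Var 0)"]) (auto simp: formulas_def)
next
  case (insert \<psi> \<Psi>)
  then obtain \<chi> where "\<chi> \<in> formulas L X" "fv \<chi> \<subseteq> insert 0 (\<Union> (fv ` \<Psi>))"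
    "\<And>U M e. sat U M e \<chi> \<longleftrightarrow> (\<forall>\<psi>\<in>\<Psi>. sat U M e \<psi>)" by auto
  then show ?case using insert.prems
    by (intro bexI[of _ "Conj \<psi> \<chi>"]) (auto simp: formulas_def)
qed

lemma sat_foldr_Ex:
  "holds M e (foldr Ex xs \<phi>) \<longleftrightarrow> (\<exists>e'. (\<forall>y. y \<notin> set xs \<longrightarrow> e' y = e y) \<and> holds M e' \<phi>)"
proof (induction xs arbitrary: e)
  case Nil
  have "e' = e" if "\<forall>y. y \<notin> set [] \<longrightarrow> e' y = e y" for e'
    using that by auto
  then show ?case by auto
next
  case (Cons x xs)
  show ?case
  proof
    assume "holds M e (foldr Ex (x # xs) \<phi>)"
    then obtain a e' where "\<forall>y. y \<notin> set xs \<longrightarrow> e' y = (e(x := a)) y" "holds M e' \<phi>"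
      using Cons.IH by auto
    then show "\<exists>e'. (\<forall>y. y \<notin> set (x # xs) \<longrightarrow> e' y = e y) \<and> holds M e' \<phi>"
      by (intro exI[of _ e']) auto
  next
    assume "\<exists>e'. (\<forall>y. y \<notin> set (x # xs) \<longrightarrow> e' y = e y) \<and> holds M e' \<phi>"
    then obtain e' where "\<forall>y. y \<notin> set (x # xs) \<longrightarrow> e' y = e y" "holds M e' \<phi>" by auto
    then have "holds M (e(x := e' x)) (foldr Ex xs \<phi>)"
      unfolding Cons.IH by (intro exI[of _ e']) auto
    then show "holds M e (foldr Ex (x # xs) \<phi>)" by auto
  qed
qed

lemma fv_foldr_Ex: "fv (foldr Ex xs \<phi>) = fv \<phi> - set xs"
  by (induction xs) auto

lemma foldr_Ex_in_formulas: "foldr Ex xs \<phi> \<in> formulas L X \<longleftrightarrow> \<phi> \<in> formulas L X"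
  by (induction xs) (auto simp: formulas_def)

section \<open>Automorphisms\<close>

lemma automorphism_fun:
  "automorphism L M h \<Longrightarrow> (f, length xs) \<in> Funs L \<Longrightarrow> h (fun_of M f xs) = fun_of M f (map h xs)"
  unfolding automorphism_def by blast

lemma automorphism_rel:
  "automorphism L M h \<Longrightarrow> (r, length xs) \<in> Rels L \<Longrightarrow> rel_of M r (map h xs) = rel_of M r xs"
  unfolding automorphism_def by blast

lemma automorphism_bij: "automorphism L M h \<Longrightarrow> bij h"
  by (simp add: automorphism_def)

lemma automorphism_eval:
  "automorphism L M h \<Longrightarrow> wf_tm L t \<Longrightarrow> eval_tm M (h \<circ> e) (inst_tm h t) = h (eval_tm M e t)"
proof (induction t)
  case (App f ts)
  then have eq: "map (eval_tm M (h \<circ> e)) (map (inst_tm h) ts) = map h (map (eval_tm M e) ts)"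
    by (auto simp: list_all_iff comp_def)
  have "(f, length (map (eval_tm M e) ts)) \<in> Funs L" using App.prems by simp
  then have "h (fun_of M f (map (eval_tm M e) ts)) = fun_of M f (map h (map (eval_tm M e) ts))"
    by (rule automorphism_fun[OF App.prems(1)])
  then show ?case by (simp only: eval_tm.simps tm.map eq)
qed auto

lemma automorphism_sat:
  assumes "automorphism L M h"
  shows "wf_fm L \<phi> \<Longrightarrow> sat (h ` U) M (h \<circ> e) (inst_fm h \<phi>) = sat U M e \<phi>"
proof (induction \<phi> arbitrary: e)
  case (Eq t u)
  moreover have "inj h" using assms by (simp add: automorphism_def bij_def)
  ultimately show ?case using assms
    by (simp only: sat.simps fm.map wf_fm.simps automorphism_eval inj_eq)
next
  case (Atom r ts)
  then have eq: "map (eval_tm M (h \<circ> e)) (map (inst_tm h) ts) = map h (map (eval_tm M e) ts)"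
    using assms by (auto simp: list_all_iff comp_def automorphism_eval[unfolded comp_def])
  have "(r, length (map (eval_tm M e) ts)) \<in> Rels L" using Atom by simp
  then have "rel_of M r (map h (map (eval_tm M e) ts)) = rel_of M r (map (eval_tm M e) ts)"
    by (rule automorphism_rel[OF assms])
  then show ?case by (simp only: sat.simps fm.map eq)
next
  case (Ex x \<phi>)
  have "sat (h ` U) M ((h \<circ> e)(x := h a)) (inst_fm h \<phi>) = sat U M (e(x := a)) \<phi>" for a
    using Ex.IH[of "e(x := a)"] Ex.prems by (simp only: fun_upd_comp wf_fm.simps)
  then show ?case by (simp only: sat.simps fm.map bex_simps)
qed auto

lemma automorphism_holds:
  assumes "automorphism L M h" "wf_fm L \<phi>"
  shows "holds M (h \<circ> e) (inst_fm h \<phi>) = holds M e \<phi>"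
  using automorphism_sat[OF assms, of UNIV e] assms(1) by (simp add: automorphism_def bij_def)

lemma inst_fm_fixed: "(\<And>a. a \<in> pars_fm \<phi> \<Longrightarrow> h a = a) \<Longrightarrow> inst_fm h \<phi> = \<phi>"
  by (rule fm.map_ident_strong)

lemma automorphism_inv:
  assumes "automorphism L M h"
  shows "automorphism L M (inv h)"
proof -
  have b: "bij h" using assms by (rule automorphism_bij)
  have map: "map h (map (inv h) xs) = xs" for xs
    using b by (simp add: bij_is_surj surj_f_inv_f map_idI)
  have "inv h (fun_of M f xs) = fun_of M f (map (inv h) xs)" if "(f, length xs) \<in> Funs L" for f xs
    using automorphism_fun[OF assms, of f "map (inv h) xs"] map[of xs] that b
    by (metis bij_inv_eq_iff length_map)
  moreover have "rel_of M r xs = rel_of M r (map (inv h) xs)" if "(r, length xs) \<in> Rels L" for r xs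
    using automorphism_rel[OF assms, of r "map (inv h) xs"] map[of xs] that
    by (metis length_map)
  ultimately show ?thesis using bij_imp_bij_inv[OF b] unfolding automorphism_def by blast
qed

lemma tp_eqI:
  assumes "\<And>\<phi> \<sigma>. \<phi> \<in> formulas L B \<Longrightarrow> \<sigma> ` fv \<phi> \<subseteq> I \<Longrightarrow> holds M (a \<circ> \<sigma>) \<phi> = holds M (b \<circ> \<sigma>) \<phi>"
  shows "tp L M I a B = tp L M I b B"
  using assms by (auto simp: tp_def)

lemma tp_eqD:
  assumes "tp L M I a B = tp L M I b B" "\<phi> \<in> formulas L B" "\<sigma> ` fv \<phi> \<subseteq> I"
  shows "holds M (a \<circ> \<sigma>) \<phi> = holds M (b \<circ> \<sigma>) \<phi>"
  using assms by (auto simp: tp_def set_eq_iff)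

lemma tp_eq_antimono:
  assumes "tp L M I a B = tp L M I b B" "J \<subseteq> I" "C \<subseteq> B"
  shows "tp L M J a C = tp L M J b C"
  using assms(2,3) formulas_mono[OF assms(3), of L] by (intro tp_eqI tp_eqD[OF assms(1)]) auto

lemma automorphism_tp:
  assumes "automorphism L M h" "\<And>c. c \<in> C \<Longrightarrow> h c = c"
  shows "tp L M I (h \<circ> a) C = tp L M I a C"
proof (rule tp_eqI)
  fix \<phi> :: "('a, 'b, 'c) fm" and \<sigma> :: "nat \<Rightarrow> 'd"
  assume \<phi>: "\<phi> \<in> formulas L C"
  then have "inst_fm h \<phi> = \<phi>"
    by (intro inst_fm_fixed assms(2)) (auto simp: formulas_def)
  then show "holds M (h \<circ> a \<circ> \<sigma>) \<phi> = holds M (a \<circ> \<sigma>) \<phi>"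
    using automorphism_holds[OF assms(1), of \<phi> "a \<circ> \<sigma>"] \<phi> by (simp add: formulas_def comp_assoc)
qed

lemma automorphism_triple_equiv:
  assumes "automorphism L M h"
  shows "triple_equiv L M A B C (h ` A) (h ` B) (h ` C)"
  unfolding triple_equiv_def using automorphism_tp[OF assms, of "{}" _ id] by (intro exI[of _ h]) auto

lemma ex_automorphism_over:
  fixes M :: "('f, 'r, 'm) struct"
  assumes hom: "strongly_homogeneous L M \<kappa>" and "small \<kappa> (A \<union> C)"
    and eq: "tp L M A g C = tp L M A id C"
  shows "\<exists>h. automorphism L M h \<and> (\<forall>c\<in>C. h c = c) \<and> (\<forall>a\<in>A. h a = g a)"
proof -
  define g' where "g' x = (if x \<in> C then x else g x)" for x
  have g: "g a = a" if "a \<in> A" "a \<in> C" for a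
    using tp_eqD[OF eq, of "Eq (Var 0) (Par a)" "\<lambda>_. a"] that by (simp add: formulas_def)
  have "tp L M (A \<union> C) g' {} = tp L M (A \<union> C) id {}"
  proof (rule tp_eqI)
    fix \<phi> :: "('f, 'r, 'm) fm" and \<sigma>
    assume \<phi>: "\<phi> \<in> formulas L {}" and \<sigma>: "\<sigma> ` fv \<phi> \<subseteq> A \<union> C"
    define \<theta> where "\<theta> y = (if \<sigma> y \<in> C then Par (\<sigma> y) else Var y :: ('f, 'm) tm)" for y
    define \<chi> where "\<chi> = tr_fm id \<theta> Par \<phi>"
    have sat: "holds M e \<chi> = holds M (\<lambda>y. if \<sigma> y \<in> C then \<sigma> y else e y) \<phi>" for e
    proof -
      have "holds M e \<chi> = holds M (\<lambda>y. eval_tm M e (\<theta> y)) (inst_fm (\<lambda>a. eval_tm M e (Par a)) \<phi>)"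
        unfolding \<chi>_def by (rule sat_tr_fm) (auto simp: \<theta>_def split: if_splits)
      also have "(\<lambda>y. eval_tm M e (\<theta> y)) = (\<lambda>y. if \<sigma> y \<in> C then \<sigma> y else e y)"
        by (auto simp: \<theta>_def)
      finally show ?thesis by (simp add: inst_fm_id)
    qed
    have "pars_fm \<chi> \<subseteq> C" "fv \<chi> \<subseteq> {y \<in> fv \<phi>. \<sigma> y \<notin> C}"
      using \<phi> pars_tr_fm[of id \<theta> Par \<phi>] fv_tr_fm[of id \<theta> Par \<phi>]
      by (fastforce simp: \<chi>_def \<theta>_def formulas_def split: if_splits)+
    moreover have "wf_fm L \<chi>"
      unfolding \<chi>_def by (rule wf_tr_fm) (use \<phi> in \<open>auto simp: \<theta>_def formulas_def\<close>)
    ultimately have "holds M (g \<circ> \<sigma>) \<chi> = holds M (id \<circ> \<sigma>) \<chi>"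
      by (intro tp_eqD[OF eq]) (use \<sigma> in \<open>auto simp: formulas_def\<close>)
    moreover have "(\<lambda>y. if \<sigma> y \<in> C then \<sigma> y else (g \<circ> \<sigma>) y) = g' \<circ> \<sigma>"
      "(\<lambda>y. if \<sigma> y \<in> C then \<sigma> y else (id \<circ> \<sigma>) y) = id \<circ> \<sigma>"
      by (auto simp: g'_def)
    ultimately show "holds M (g' \<circ> \<sigma>) \<phi> = holds M (id \<circ> \<sigma>) \<phi>"
      unfolding sat by simp
  qed
  then obtain h where "automorphism L M h" "\<forall>a\<in>A \<union> C. h a = g' a"
    using hom \<open>small \<kappa> (A \<union> C)\<close> unfolding strongly_homogeneous_def by blast
  then show ?thesis using g by (intro exI[of _ h]) (auto simp: g'_def)
qed

section \<open>The downward Loewenheim-Skolem theorem\<close>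

lemma card_image_ordLeq: "|X| \<le>o |Z| \<Longrightarrow> |f ` X| \<le>o |Z|"
  by (rule ordLeq_transitive[OF card_of_image])

lemma card_subset_ordLeq: "X \<subseteq> Y \<Longrightarrow> |Y| \<le>o |Z| \<Longrightarrow> |X| \<le>o |Z|"
  by (rule ordLeq_transitive[OF card_of_mono1])

lemma card_Un_ordLeq: "infinite Z \<Longrightarrow> |X| \<le>o |Z| \<Longrightarrow> |Y| \<le>o |Z| \<Longrightarrow> |X \<union> Y| \<le>o |Z|"
  by (rule card_of_Un_ordLeq_infinite_Field) (simp_all add: Field_card_of, rule card_of_card_order_on)

lemma card_Times_ordLeq: "infinite Z \<Longrightarrow> |X| \<le>o |Z| \<Longrightarrow> |Y| \<le>o |Z| \<Longrightarrow> |X \<times> Y| \<le>o |Z|"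
  by (rule card_of_Times_ordLeq_infinite_Field) (simp_all add: Field_card_of, rule card_of_card_order_on)

lemma card_nat_ordLeq: "infinite Z \<Longrightarrow> |A :: nat set| \<le>o |Z|"
  using infinite_iff_card_of_nat[of Z] card_subset_ordLeq[of A UNIV] by blast

lemma card_UN_nat_ordLeq: "infinite Z \<Longrightarrow> (\<And>n :: nat. |X n| \<le>o |Z| ) \<Longrightarrow> |\<Union>n. X n| \<le>o |Z|"
  by (rule card_of_UNION_ordLeq_infinite) (auto simp: card_nat_ordLeq)

lemma card_lists_ordLeq:
  assumes "infinite Z" "|X| \<le>o |Z|"
  shows "|lists X| \<le>o |Z|"
proof -
  have "|{xs \<in> lists X. length xs = n}| \<le>o |Z|" for n
  proof (induction n)
    case 0
    have "{xs \<in> lists X. length xs = 0} \<subseteq> (\<lambda>_. []) ` {0 :: nat}" by auto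
    then show ?case
      by (rule card_subset_ordLeq) (intro card_image_ordLeq card_nat_ordLeq assms(1))
  next
    case (Suc n)
    have "{xs \<in> lists X. length xs = Suc n} \<subseteq> (\<lambda>(x, xs). x # xs) ` (X \<times> {xs \<in> lists X. length xs = n})"
      by (auto simp: length_Suc_conv image_iff)
    then show ?case
      by (rule card_subset_ordLeq) (intro card_image_ordLeq card_Times_ordLeq assms Suc.IH)
  qed
  then have "|\<Union>n. {xs \<in> lists X. length xs = n}| \<le>o |Z|"
    using assms(1) by (intro card_UN_nat_ordLeq)
  moreover have "(\<Union>n. {xs \<in> lists X. length xs = n}) = lists X" by auto
  ultimately show ?thesis by simp
qed

lemma size_arg_App: "t \<in> set ts \<Longrightarrow> size t < size (App f ts)"
  by (induction ts) auto

lemma card_terms_ordLeq: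
  fixes L :: "('f, 'r) lang"
  assumes Z: "infinite Z" "|Funs L| \<le>o |Z|"
  shows "|{t :: ('f, 'm) tm. wf_tm L t \<and> pars_tm t = {}}| \<le>o |Z|"
proof -
  define T where "T n = {t :: ('f, 'm) tm. wf_tm L t \<and> pars_tm t = {} \<and> size t < n}" for n
  have "|T n| \<le>o |Z|" for n
  proof (induction n)
    case 0
    have "T 0 \<subseteq> Var ` {}" by (auto simp: T_def)
    then show ?case
      by (rule card_subset_ordLeq) (intro card_image_ordLeq card_nat_ordLeq Z(1))
  next
    case (Suc n)
    have "T (Suc n) \<subseteq> Var ` UNIV \<union> (\<lambda>(p, ts). App (fst p) ts) ` (Funs L \<times> lists (T n))"
    proof
      fix t assume t: "t \<in> T (Suc n)"
      then show "t \<in> Var ` UNIV \<union> (\<lambda>(p, ts). App (fst p) ts) ` (Funs L \<times> lists (T n))"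
      proof (cases t)
        case (App f ts)
        have "ts \<in> lists (T n)"
          using t size_arg_App[of _ ts f] by (fastforce simp: App T_def list_all_iff)
        then have "((f, length ts), ts) \<in> Funs L \<times> lists (T n)"
          using t by (simp add: App T_def)
        then show ?thesis unfolding App
          by (intro UnI2 image_eqI[of _ _ "((f, length ts), ts)"]) simp_all
      qed (auto simp: T_def)
    qed
    moreover have "|Var ` UNIV \<union> (\<lambda>(p, ts). App (fst p) ts) ` (Funs L \<times> lists (T n))| \<le>o |Z|"
      by (intro card_Un_ordLeq card_image_ordLeq card_Times_ordLeq card_nat_ordLeq card_lists_ordLeq Z Suc.IH)
    ultimately show ?case by (rule card_subset_ordLeq)
  qed
  then have "|\<Union>n. T n| \<le>o |Z|"
    using Z(1) by (intro card_UN_nat_ordLeq)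
  moreover have "(\<Union>n. T n) = {t. wf_tm L t \<and> pars_tm t = {}}" by (auto simp: T_def)
  ultimately show ?thesis by simp
qed

lemma card_formulas_ordLeq:
  fixes L :: "('f, 'r) lang"
  assumes Z: "infinite Z" "|Funs L| \<le>o |Z|" "|Rels L| \<le>o |Z|"
  shows "|formulas L {} :: ('f, 'r, 'm) fm set| \<le>o |Z|"
proof -
  define T where "T = {t :: ('f, 'm) tm. wf_tm L t \<and> pars_tm t = {}}"
  define F where "F n = {\<phi> :: ('f, 'r, 'm) fm. \<phi> \<in> formulas L {} \<and> size \<phi> < n}" for n
  have T: "|T| \<le>o |Z|" unfolding T_def by (rule card_terms_ordLeq[OF Z(1,2)])
  have "|F n| \<le>o |Z|" for n
  proof (induction n)
    case 0
    have "F 0 \<subseteq> (\<lambda>(s, t). Eq s t) ` (T \<times> T)" by (auto simp: F_def)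
    moreover have "|(\<lambda>(s, t). Eq s t :: ('f, 'r, 'm) fm) ` (T \<times> T)| \<le>o |Z|"
      by (intro card_image_ordLeq card_Times_ordLeq Z T)
    ultimately show ?case by (rule card_subset_ordLeq)
  next
    case (Suc n)
    let ?S = "(\<lambda>(s, t). Eq s t) ` (T \<times> T) \<union> (\<lambda>(p, ts). Atom (fst p) ts) ` (Rels L \<times> lists T)
      \<union> Neg ` F n \<union> (\<lambda>(\<phi>, \<psi>). Conj \<phi> \<psi>) ` (F n \<times> F n) \<union> (\<lambda>(x, \<phi>). Ex x \<phi>) ` (UNIV \<times> F n)"
    have "F (Suc n) \<subseteq> ?S"
    proof
      fix \<phi> assume \<phi>: "\<phi> \<in> F (Suc n)"
      show "\<phi> \<in> ?S"
      proof (cases \<phi>)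
        case (Atom r ts)
        have "((r, length ts), ts) \<in> Rels L \<times> lists T"
          using \<phi> by (auto simp: Atom F_def formulas_def T_def list_all_iff)
        then have "\<phi> \<in> (\<lambda>(p, ts). Atom (fst p) ts) ` (Rels L \<times> lists T)"
          unfolding Atom by (intro image_eqI[of _ _ "((r, length ts), ts)"]) simp_all
        then show ?thesis by blast
      qed (use \<phi> in \<open>auto simp: F_def formulas_def T_def\<close>)
    qed
    moreover have "|?S| \<le>o |Z|"
      by (intro card_Un_ordLeq card_image_ordLeq card_Times_ordLeq card_nat_ordLeq card_lists_ordLeq
          Z T Suc.IH)
    ultimately show ?case by (rule card_subset_ordLeq)
  qed
  then have "|\<Union>n. F n| \<le>o |Z|"
    using Z(1) by (intro card_UN_nat_ordLeq)
  moreover have "(\<Union>n. F n) = formulas L {}" by (auto simp: F_def)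
  ultimately show ?thesis by simp
qed

lemma sat_elementary:
  assumes wit: "\<And>\<phi> x e a. \<phi> \<in> formulas L {} \<Longrightarrow> range e \<subseteq> N \<Longrightarrow> holds M (e(x := a)) \<phi>
      \<Longrightarrow> \<exists>b\<in>N. holds M (e(x := b)) \<phi>"
  shows "\<phi> \<in> formulas L {} \<Longrightarrow> range e \<subseteq> N \<Longrightarrow> sat N M e \<phi> = holds M e \<phi>"
proof (induction \<phi> arbitrary: e)
  case (Ex x \<phi>)
  have \<phi>: "\<phi> \<in> formulas L {}" using Ex.prems(1) by (simp add: formulas_def)
  have IH: "sat N M (e(x := b)) \<phi> = holds M (e(x := b)) \<phi>" if "b \<in> N" for b
    using Ex.prems that by (intro Ex.IH \<phi>) auto
  then show ?case using wit[OF \<phi> Ex.prems(2)] by auto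
qed (auto simp: formulas_def)

lemma infinite_Field_if_natLeq_ordLess:
  assumes "Card_order \<kappa>" "natLeq <o \<kappa>"
  shows "infinite (Field \<kappa>)"
proof -
  have "natLeq \<le>o |Field \<kappa>|"
    by (rule ordLeq_ordIso_trans[OF ordLess_imp_ordLeq[OF assms(2)]
          ordIso_symmetric[OF card_of_Field_ordIso[OF assms(1)]]])
  then show ?thesis using infinite_iff_natLeq_ordLeq by blast
qed

lemma ex_small_model:
  fixes L :: "('f, 'r) lang" and T :: "('f, 'r, 'm) fm set"
    and M :: "('f, 'r, 'm) struct" and \<kappa> :: "'k rel"
  assumes "monster_model L T M \<kappa>" "small \<kappa> X"
  shows "\<exists>N. X \<subseteq> N \<and> small_model L M \<kappa> N"
proof -
  define Z where "Z = ((X <+> (UNIV :: nat set)) <+> Funs L) <+> Rels L"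
  have \<kappa>: "Card_order \<kappa>" "natLeq <o \<kappa>" "|Funs L| <o \<kappa>" "|Rels L| <o \<kappa>"
    using assms(1) by (auto simp: monster_model_def)
  have inf\<kappa>: "infinite (Field \<kappa>)" using \<kappa>(1,2) by (rule infinite_Field_if_natLeq_ordLess)
  have "|UNIV :: nat set| <o \<kappa>"
    using card_of_nat \<kappa>(2) by (rule ordIso_ordLess_trans)
  then have "|Z| <o \<kappa>" unfolding Z_def using assms(2)
    by (intro card_of_Plus_ordLess_infinite_Field inf\<kappa> \<kappa>) (auto simp: small_def)
  have Z: "infinite Z" "|X| \<le>o |Z|" "|Funs L| \<le>o |Z|" "|Rels L| \<le>o |Z|"
  proof -
    show "infinite Z" by (simp add: Z_def)
    have "\<exists>f. inj_on f X \<and> f ` X \<subseteq> Z"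
      by (rule exI[of _ "\<lambda>x. Inl (Inl (Inl x))"]) (auto simp: Z_def inj_on_def)
    then show "|X| \<le>o |Z|" by (simp add: card_of_ordLeq)
    have "\<exists>f. inj_on f (Funs L) \<and> f ` Funs L \<subseteq> Z"
      by (rule exI[of _ "\<lambda>x. Inl (Inr x)"]) (auto simp: Z_def inj_on_def)
    then show "|Funs L| \<le>o |Z|" by (simp add: card_of_ordLeq)
    have "\<exists>f. inj_on f (Rels L) \<and> f ` Rels L \<subseteq> Z"
      by (rule exI[of _ Inr]) (auto simp: Z_def inj_on_def)
    then show "|Rels L| \<le>o |Z|" by (simp add: card_of_ordLeq)
  qed
  define env where "env vs n = (if n < length vs then vs ! n else undefined :: 'm)" for vs n
  define W where "W = (\<lambda>(\<phi> :: ('f, 'r, 'm) fm, x, vs). SOME a. holds M ((env vs)(x := a)) \<phi>)"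
  define G where "G = rec_nat (insert undefined X)
      (\<lambda>_ Y. Y \<union> W ` (formulas L {} \<times> UNIV \<times> lists Y))"
  have G0: "G 0 = insert undefined X"
    and GS: "G (Suc n) = G n \<union> W ` (formulas L {} \<times> UNIV \<times> lists (G n))" for n
    by (simp_all add: G_def)
  have "mono G" unfolding mono_iff_le_Suc by (auto simp: GS)
  define N where "N = (\<Union>n. G n)"
  have "|G n| \<le>o |Z|" for n
  proof (induction n)
    case 0
    have "|{0 :: nat}| \<le>o |Z|" by (rule card_nat_ordLeq[OF Z(1)])
    then have "|(\<lambda>_. undefined) ` {0 :: nat} \<union> X| \<le>o |Z|"
      by (intro card_Un_ordLeq card_image_ordLeq Z)
    then show ?case by (simp add: G0)
  next
    case (Suc n)
    then show ?case unfolding GS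
      by (intro card_Un_ordLeq card_image_ordLeq card_Times_ordLeq card_nat_ordLeq card_lists_ordLeq
          card_formulas_ordLeq Z)
  qed
  then have "|N| \<le>o |Z|" unfolding N_def by (intro card_UN_nat_ordLeq Z)
  then have "small \<kappa> N"
    using \<open>|Z| <o \<kappa>\<close> unfolding small_def by (rule ordLeq_ordLess_trans)
  have wit: "\<exists>b\<in>N. holds M (e(x := b)) \<phi>"
    if \<phi>: "\<phi> \<in> formulas L {}" and e: "range e \<subseteq> N" and a: "holds M (e(x := a)) \<phi>" for \<phi> x e a
  proof -
    obtain m where m: "\<And>y. y \<in> fv \<phi> \<Longrightarrow> y < m"
      using finite_nat_set_iff_bounded[of "fv \<phi>"] finite_fv[of \<phi>] by blast
    define vs where "vs = map e [0..<m]"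
    have env: "holds M ((env vs)(x := b)) \<phi> = holds M (e(x := b)) \<phi>" for b
      by (rule sat_cong) (use m in \<open>auto simp: env_def vs_def\<close>)
    have "finite (set vs)" "set vs \<subseteq> N" using e by (auto simp: vs_def)
    then have "\<exists>n. set vs \<subseteq> G n"
    proof (induction rule: finite_induct)
      case (insert v F)
      then obtain n k where "F \<subseteq> G n" "v \<in> G k" by (auto simp: N_def)
      then have "insert v F \<subseteq> G (max n k)"
        using monoD[OF \<open>mono G\<close>, of n "max n k"] monoD[OF \<open>mono G\<close>, of k "max n k"] by auto
      then show ?case by blast
    qed auto
    then obtain n where "vs \<in> lists (G n)" by auto
    then have "W (\<phi>, x, vs) \<in> G (Suc n)" using \<phi> by (simp add: GS)
    moreover have "holds M ((env vs)(x := W (\<phi>, x, vs))) \<phi>"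
      unfolding W_def prod.case by (rule someI[of _ a]) (simp only: env a)
    ultimately show ?thesis unfolding env by (auto simp: N_def)
  qed
  have "undefined \<in> N" using G0 by (auto simp: N_def)
  have "fun_of M f xs \<in> N" if "(f, length xs) \<in> Funs L" "set xs \<subseteq> N" for f xs
  proof -
    let ?\<phi> = "Eq (Var 0) (App f (map (\<lambda>i. Var (Suc i)) [0..<length xs])) :: ('f, 'r, 'm) fm"
    define e where "e n = (case n of 0 \<Rightarrow> undefined | Suc i \<Rightarrow> if i < length xs then xs ! i else undefined)" for n
    have "?\<phi> \<in> formulas L {}" using that(1) by (auto simp: formulas_def list_all_iff)
    moreover have "range e \<subseteq> N"
      using that(2) \<open>undefined \<in> N\<close> by (auto simp: e_def subset_iff split: nat.splits)
    moreover have eval: "holds M (e(0 := b)) ?\<phi> \<longleftrightarrow> b = fun_of M f xs" for b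
    proof -
      have "map (\<lambda>i. e (Suc i)) [0..<length xs] = xs"
        by (rule nth_equalityI) (auto simp: e_def)
      then show ?thesis by (simp add: comp_def)
    qed
    ultimately show ?thesis using wit[of ?\<phi> e 0 "fun_of M f xs"] by (simp only: eval simp_thms) blast
  qed
  moreover have "sat N M e \<phi> = holds M e \<phi>" if "\<phi> \<in> formulas L {}" "range e \<subseteq> N" for \<phi> e
    by (rule sat_elementary) (erule (2) wit, fact that(1), fact that(2))
  moreover have "X \<subseteq> N" using G0 by (auto simp: N_def)
  ultimately show ?thesis
    using \<open>small \<kappa> N\<close> \<open>undefined \<in> N\<close> unfolding small_model_def by blast
qed

section \<open>Limits of types along an ultrafilter\<close>

lemma ex_nonprincipal_ultrafilter:
  "\<exists>U :: nat filter. U \<le> sequentially \<and> U \<noteq> bot \<and> (\<forall>P. eventually P U \<or> eventually (\<lambda>i. \<not> P i) U)"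
proof -
  define A where "A = {F :: nat filter. F \<le> sequentially \<and> F \<noteq> bot}"
  have "\<exists>m\<in>A. \<forall>a\<in>A. m \<ge> a \<longrightarrow> a = m"
  proof (rule predicate_Zorn)
    show "partial_order_on A (relation_of (\<ge>) A)"
      by (rule partial_order_on_relation_ofI) auto
  next
    fix C assume "C \<in> Chains (relation_of (\<ge>) A)"
    then have C: "\<And>F G. F \<in> C \<Longrightarrow> G \<in> C \<Longrightarrow> F \<le> G \<or> G \<le> F" "C \<subseteq> A"
      by (auto simp: Chains_def relation_of_def)
    show "\<exists>u\<in>A. \<forall>a\<in>C. u \<le> a"
    proof (cases "C = {}")
      case True
      then show ?thesis by (auto simp: A_def intro!: exI[of _ sequentially])
    next
      case False
      have "eventually P (Inf C) \<longleftrightarrow> (\<exists>F\<in>C. eventually P F)" for P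
      proof (rule eventually_Inf_base)
        fix F G assume "F \<in> C" "G \<in> C"
        then show "\<exists>x\<in>C. x \<le> inf F G"
          using C(1)[of F G] by (metis inf.absorb1 inf.absorb2 order_refl)
      qed (rule False)
      then have "Inf C \<noteq> bot"
        using C(2) by (auto simp: trivial_limit_def A_def)
      moreover have "Inf C \<le> sequentially"
        using False C(2) by (auto simp: A_def intro: Inf_lower2)
      ultimately show ?thesis by (auto simp: A_def intro!: bexI[of _ "Inf C"] Inf_lower)
    qed
  qed
  then obtain U where U: "U \<in> A" "\<And>F. F \<in> A \<Longrightarrow> F \<le> U \<Longrightarrow> F = U" by auto
  have "eventually (\<lambda>i. \<not> P i) U" if "\<not> eventually P U" for P
  proof -
    let ?F = "inf U (principal {i. \<not> P i})"
    have "?F \<noteq> bot" using that by (auto simp: trivial_limit_def eventually_inf_principal)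
    then have "?F = U" using U(1) by (intro U(2)) (auto simp: A_def intro: le_infI1)
    moreover have "eventually (\<lambda>i. \<not> P i) ?F" by (simp add: eventually_inf_principal)
    ultimately show ?thesis by simp
  qed
  then show ?thesis using U(1) by (auto simp: A_def)
qed

lemma small_finite: "natLeq <o \<kappa> \<Longrightarrow> finite A \<Longrightarrow> small \<kappa> A"
  unfolding small_def using finite_iff_ordLess_natLeq ordLess_transitive by blast

lemma small_subset: "A \<subseteq> B \<Longrightarrow> small \<kappa> B \<Longrightarrow> small \<kappa> A"
  unfolding small_def using card_of_mono1 ordLeq_ordLess_trans by blast

lemma small_image: "small \<kappa> A \<Longrightarrow> small \<kappa> (f ` A)"
  unfolding small_def using card_of_image ordLeq_ordLess_trans by blast

lemma small_Un: "Card_order \<kappa> \<Longrightarrow> natLeq <o \<kappa> \<Longrightarrow> small \<kappa> A \<Longrightarrow> small \<kappa> B \<Longrightarrow> small \<kappa> (A \<union> B)"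
  unfolding small_def by (rule card_of_Un_ordLess_infinite_Field[OF infinite_Field_if_natLeq_ordLess])

lemma small_UN_nat_finite:
  assumes "natLeq <o \<kappa>" "\<And>n :: nat. finite (X n)"
  shows "small \<kappa> (\<Union>n. X n)"
proof -
  have "|X n| \<le>o |UNIV :: nat set|" for n
    using finite_imp_inj_to_nat_seg[OF assms(2)[of n]] by (auto simp flip: card_of_ordLeq)
  then have "|\<Union>n. X n| \<le>o |UNIV :: nat set|" by (intro card_UN_nat_ordLeq) auto
  then show ?thesis
    unfolding small_def by (metis assms(1) card_of_nat ordLeq_ordIso_trans ordLeq_ordLess_trans)
qed

locale ultrafilter =
  fixes U :: "nat filter"
  assumes not_bot: "U \<noteq> bot" and ultra: "\<And>P. \<not> eventually P U \<Longrightarrow> eventually (\<lambda>i. \<not> P i) U"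

definition realises_limit :: "('f, 'r) lang \<Rightarrow> ('f, 'r, 'm) struct \<Rightarrow> nat filter \<Rightarrow> 'i set
    \<Rightarrow> (nat \<Rightarrow> 'i \<Rightarrow> 'm) \<Rightarrow> 'm set \<Rightarrow> ('i \<Rightarrow> 'm) \<Rightarrow> bool" where
  "realises_limit L M U I \<beta> X \<gamma> \<longleftrightarrow>
     (\<forall>\<psi>\<in>formulas L X. \<forall>\<tau>. \<tau> ` fv \<psi> \<subseteq> I \<longrightarrow>
        holds M (\<gamma> \<circ> \<tau>) \<psi> = (\<forall>\<^sub>F i in U. holds M (\<beta> i \<circ> \<tau>) \<psi>))"

lemma realises_limitD:
  "realises_limit L M U I \<beta> X \<gamma> \<Longrightarrow> \<psi> \<in> formulas L X \<Longrightarrow> \<tau> ` fv \<psi> \<subseteq> I \<Longrightarrow>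
     holds M (\<gamma> \<circ> \<tau>) \<psi> = (\<forall>\<^sub>F i in U. holds M (\<beta> i \<circ> \<tau>) \<psi>)"
  by (simp add: realises_limit_def)

lemma realises_limit_antimono:
  "realises_limit L M U I \<beta> X \<gamma> \<Longrightarrow> Y \<subseteq> X \<Longrightarrow> realises_limit L M U I \<beta> Y \<gamma>"
  using formulas_mono[of Y X L] unfolding realises_limit_def by blast

lemma realises_limit_cong:
  assumes "realises_limit L M U I \<beta> X \<gamma>" "\<And>p. p \<in> I \<Longrightarrow> \<gamma> p = \<gamma>' p"
  shows "realises_limit L M U I \<beta> X \<gamma>'"
  unfolding realises_limit_def
proof (intro ballI allI impI)
  fix \<psi> and \<tau> :: "nat \<Rightarrow> 'd"
  assume \<psi>: "\<psi> \<in> formulas L X" and \<tau>: "\<tau> ` fv \<psi> \<subseteq> I"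
  have "holds M (\<gamma>' \<circ> \<tau>) \<psi> = holds M (\<gamma> \<circ> \<tau>) \<psi>"
    by (rule sat_cong) (use \<tau> assms(2) in auto)
  then show "holds M (\<gamma>' \<circ> \<tau>) \<psi> = (\<forall>\<^sub>F i in U. holds M (\<beta> i \<circ> \<tau>) \<psi>)"
    using realises_limitD[OF assms(1) \<psi> \<tau>] by simp
qed

lemma realises_limit_automorphism:
  assumes h: "automorphism L M h" and lim: "realises_limit L M U I \<beta> X \<gamma>"
  shows "realises_limit L M U I (\<lambda>i. h \<circ> \<beta> i) (h ` X) (h \<circ> \<gamma>)"
  unfolding realises_limit_def
proof (intro ballI allI impI)
  fix \<psi> and \<tau> :: "nat \<Rightarrow> 'd"
  assume \<psi>: "\<psi> \<in> formulas L (h ` X)" and \<tau>: "\<tau> ` fv \<psi> \<subseteq> I"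
  define \<psi>' where "\<psi>' = inst_fm (inv h) \<psi>"
  have b: "bij h" using h by (rule automorphism_bij)
  have "inv h ` pars_fm \<psi> \<subseteq> inv h ` h ` X" using \<psi> by (auto simp: formulas_def)
  also have "inv h ` h ` X = X" using b by (simp add: bij_is_inj image_inv_f_f)
  finally have \<psi>': "\<psi>' \<in> formulas L X" "\<tau> ` fv \<psi>' \<subseteq> I"
    using \<tau> unfolding \<psi>'_def by (simp_all add: fv_inst_fm inst_fm_in_formulas[OF \<psi>])
  have eq: "\<psi> = inst_fm h \<psi>'"
    using b by (simp add: \<psi>'_def inst_fm_inst_fm bij_is_surj surj_f_inv_f inst_fm_id)
  have "holds M (h \<circ> e) \<psi> = holds M e \<psi>'" for e
    unfolding eq by (rule automorphism_holds[OF h]) (use \<psi>' in \<open>simp add: formulas_def\<close>)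
  then show "holds M (h \<circ> \<gamma> \<circ> \<tau>) \<psi> = (\<forall>\<^sub>F i in U. holds M (h \<circ> \<beta> i \<circ> \<tau>) \<psi>)"
    using realises_limitD[OF lim \<psi>'] by (simp add: comp_assoc)
qed

lemma realises_limit_tp_eq:
  assumes "realises_limit L M U I \<beta> X \<gamma>" "realises_limit L M U I \<beta> X \<gamma>'"
  shows "tp L M I \<gamma> X = tp L M I \<gamma>' X"
  by (rule tp_eqI) (simp add: realises_limitD[OF assms(1)] realises_limitD[OF assms(2)])

lemma realises_limit_indep_h:
  assumes lim: "realises_limit L M U I \<beta> X \<gamma>" and "U \<noteq> bot" and N: "\<And>i. \<beta> i ` I \<subseteq> N" and X: "B \<union> N \<subseteq> X"
  shows "indep_h L M (\<gamma> ` I) N B"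
  unfolding indep_h_def
proof clarify
  fix \<psi> \<sigma> assume "(\<psi>, \<sigma>) \<in> tp L M (\<gamma> ` I) id (B \<union> N)"
  then have \<psi>: "\<psi> \<in> formulas L X" "\<sigma> ` fv \<psi> \<subseteq> \<gamma> ` I" "holds M \<sigma> \<psi>"
    using formulas_mono[OF X] by (auto simp: tp_def)
  define \<tau> where "\<tau> = inv_into I \<gamma> \<circ> \<sigma>"
  have "holds M (\<gamma> \<circ> \<tau>) \<psi> = holds M \<sigma> \<psi>"
    by (rule sat_cong) (use \<psi>(2) in \<open>auto simp: \<tau>_def f_inv_into_f\<close>)
  moreover have "\<tau> ` fv \<psi> \<subseteq> I"
    using \<psi>(2) unfolding \<tau>_def o_apply by (intro image_subsetI) (simp, rule inv_into_into, blast)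
  ultimately have "\<forall>\<^sub>F i in U. holds M (\<beta> i \<circ> \<tau>) \<psi>"
    using realises_limitD[OF lim \<psi>(1)] \<psi>(3) by simp
  then obtain i where "holds M (\<beta> i \<circ> \<tau>) \<psi>"
    using eventually_happens'[OF \<open>U \<noteq> bot\<close>] by blast
  moreover have "(\<beta> i \<circ> inv_into I \<gamma>) ` \<gamma> ` I \<subseteq> N"
    using N[of i] inv_into_into[of _ \<gamma> I] by (auto simp: subset_iff image_iff)
  ultimately show "\<exists>g. g ` \<gamma> ` I \<subseteq> N \<and> holds M (g \<circ> \<sigma>) \<psi>"
    by (intro exI[of _ "\<beta> i \<circ> inv_into I \<gamma>"]) (simp add: \<tau>_def comp_assoc)
qed

lemma (in ultrafilter) ex_assignment_realising_limit:
  fixes M :: "('f, 'r, 'm) struct"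
  assumes sat: "saturated L M \<kappa>" and \<kappa>: "Card_order \<kappa>" "natLeq <o \<kappa>" and X: "small \<kappa> X"
  shows "\<exists>e. \<forall>\<psi>\<in>formulas L X. fv \<psi> \<subseteq> {..<n} \<longrightarrow> holds M e \<psi> = (\<forall>\<^sub>F i in U. holds M (E i) \<psi>)"
proof (induction n)
  case 0
  show ?case
  proof (intro exI[of _ "E 0"] ballI impI)
    fix \<psi> :: "('f, 'r, 'm) fm" assume "fv \<psi> \<subseteq> {..<0}"
    then have "holds M (E i) \<psi> = holds M (E 0) \<psi>" for i by (intro sat_cong) auto
    then obtain c where "\<And>i. holds M (E i) \<psi> = c" by blast
    then show "holds M (E 0) \<psi> = (\<forall>\<^sub>F i in U. holds M (E i) \<psi>)" using not_bot by simp
  qed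
next
  case (Suc n)
  then obtain e where e: "\<And>\<psi>. \<psi> \<in> formulas L X \<Longrightarrow> fv \<psi> \<subseteq> {..<n} \<Longrightarrow>
      holds M e \<psi> = (\<forall>\<^sub>F i in U. holds M (E i) \<psi>)" by blast
  define \<theta> where "\<theta> y = (if y = n then Var 0 else Par (e y) :: ('f, 'm) tm)" for y
  define \<T> where "\<T> = (tr_fm Suc \<theta> Par :: ('f, 'r, 'm) fm \<Rightarrow> _)"
  define G where "G = {\<psi> \<in> formulas L X. fv \<psi> \<subseteq> {..n} \<and> (\<forall>\<^sub>F i in U. holds M (E i) \<psi>)}"
  have holds: "holds M e' (\<T> \<psi>) = holds M (e(n := e' 0)) \<psi>" for e' \<psi>
  proof -
    have "holds M e' (\<T> \<psi>) = holds M (\<lambda>y. eval_tm M e' (\<theta> y)) (inst_fm (\<lambda>a. eval_tm M e' (Par a)) \<psi>)"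
      unfolding \<T>_def by (rule sat_tr_fm) (auto simp: \<theta>_def split: if_splits)
    also have "(\<lambda>y. eval_tm M e' (\<theta> y)) = e(n := e' 0)" by (auto simp: \<theta>_def)
    finally show ?thesis by (simp only: inst_fm_id eval_tm.simps)
  qed
  have "\<T> \<psi> \<in> formulas L (X \<union> e ` {..<n})" "fv (\<T> \<psi>) \<subseteq> {0}" if "\<psi> \<in> G" for \<psi>
  proof -
    have "wf_fm L (\<T> \<psi>)"
      unfolding \<T>_def by (rule wf_tr_fm) (use that in \<open>auto simp: G_def formulas_def \<theta>_def\<close>)
    moreover have "pars_fm (\<T> \<psi>) \<subseteq> X \<union> e ` {..<n}"
    proof
      fix a assume "a \<in> pars_fm (\<T> \<psi>)"
      then have "(\<exists>y\<in>fv \<psi>. a \<in> pars_tm (\<theta> y)) \<or> a \<in> pars_fm \<psi>"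
        using pars_tr_fm[of Suc \<theta> Par \<psi>] unfolding \<T>_def by auto
      then show "a \<in> X \<union> e ` {..<n}"
        using that by (auto simp: G_def formulas_def \<theta>_def order_le_less subset_iff split: if_splits)
    qed
    ultimately show "\<T> \<psi> \<in> formulas L (X \<union> e ` {..<n})" by (simp add: formulas_def)
    show "fv (\<T> \<psi>) \<subseteq> {0}"
      using fv_tr_fm[of Suc \<theta> Par \<psi>] unfolding \<T>_def by (auto simp: \<theta>_def split: if_splits)
  qed
  then have p: "\<T> ` G \<subseteq> {\<phi> \<in> formulas L (X \<union> e ` {..<n}). fv \<phi> \<subseteq> {0}}" by auto
  have fs: "\<exists>a. \<forall>\<phi>\<in>q. holds M (\<lambda>_. a) \<phi>" if q: "q \<subseteq> \<T> ` G" "finite q" for q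
  proof -
    obtain \<Psi> where \<Psi>: "finite \<Psi>" "\<Psi> \<subseteq> G" "q = \<T> ` \<Psi>"
      using finite_subset_image[OF q(2,1)] by blast
    then have "\<Psi> \<subseteq> formulas L X" by (auto simp: G_def)
    from ex_finite_conj[OF \<Psi>(1) this] obtain \<chi>
      where \<chi>: "\<chi> \<in> formulas L X" "fv \<chi> \<subseteq> insert 0 (\<Union> (fv ` \<Psi>))"
      "\<And>e. holds M e \<chi> \<longleftrightarrow> (\<forall>\<psi>\<in>\<Psi>. holds M e \<psi>)" by blast
    have "\<forall>\<^sub>F i in U. \<forall>\<psi>\<in>\<Psi>. holds M (E i) \<psi>"
      using \<Psi>(1,2) by (intro eventually_ball_finite) (auto simp: G_def)
    then have "\<forall>\<^sub>F i in U. holds M (E i) (Ex n \<chi>)"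
    proof eventually_elim
      case (elim i)
      then have "holds M ((E i)(n := E i n)) \<chi>" by (simp add: \<chi>(3))
      then show ?case unfolding sat.simps by blast
    qed
    moreover have "Ex n \<chi> \<in> formulas L X" using \<chi>(1) by (simp add: formulas_def)
    moreover have "fv (Ex n \<chi>) \<subseteq> {..<n}"
    proof
      fix y assume y: "y \<in> fv (Ex n \<chi>)"
      then have "y \<le> n" using \<chi>(2) \<Psi>(2) by (fastforce simp: G_def)
      then show "y \<in> {..<n}" using y by auto
    qed
    ultimately have "holds M e (Ex n \<chi>)" using e by blast
    then obtain a where "holds M (e(n := a)) \<chi>" by auto
    then show ?thesis unfolding \<Psi>(3) by (auto simp: holds \<chi>(3) simp del: fun_upd_apply)
  qed
  have "small \<kappa> (X \<union> e ` {..<n})"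
    by (intro small_Un \<kappa> X small_finite) simp
  with sat p fs obtain a where a: "\<And>\<phi>. \<phi> \<in> \<T> ` G \<Longrightarrow> holds M (\<lambda>_. a) \<phi>"
    unfolding saturated_def by meson
  have a: "holds M (e(n := a)) \<psi>" if "\<psi> \<in> G" for \<psi>
    using a[of "\<T> \<psi>"] that by (simp add: holds del: fun_upd_apply)
  show ?case
  proof (intro exI[of _ "e(n := a)"] ballI impI)
    fix \<psi> assume \<psi>: "\<psi> \<in> formulas L X" "fv \<psi> \<subseteq> {..<Suc n}"
    show "holds M (e(n := a)) \<psi> = (\<forall>\<^sub>F i in U. holds M (E i) \<psi>)"
    proof (cases "\<forall>\<^sub>F i in U. holds M (E i) \<psi>")
      case True
      then have "\<psi> \<in> G" using \<psi> by (auto simp: G_def)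
      then show ?thesis using True a by blast
    next
      case False
      then have "\<forall>\<^sub>F i in U. holds M (E i) (Neg \<psi>)" using ultra by fastforce
      then have "Neg \<psi> \<in> G" using \<psi> by (auto simp: G_def formulas_def)
      then show ?thesis using False a[of "Neg \<psi>"] by simp
    qed
  qed
qed

lemma (in ultrafilter) ex_realises_limit:
  fixes M :: "('f, 'r, 'm) struct" and \<beta> :: "nat \<Rightarrow> 'i \<Rightarrow> 'm"
  assumes sat: "saturated L M \<kappa>" and \<kappa>: "Card_order \<kappa>" "natLeq <o \<kappa>" and X: "small \<kappa> X" and "finite I"
  shows "\<exists>\<gamma>. realises_limit L M U I \<beta> X \<gamma>"
proof -
  obtain f n where f: "bij_betw f I {0..<n :: nat}"
    using ex_bij_betw_finite_nat[OF \<open>finite I\<close>] by blast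
  have f_less: "f p < n" if "p \<in> I" for p using f that by (auto simp: bij_betw_def)
  have f_inv: "inv_into I f (f p) = p" if "p \<in> I" for p
    using f that by (auto simp: bij_betw_def)
  obtain e where e: "\<And>\<psi>. \<psi> \<in> formulas L X \<Longrightarrow> fv \<psi> \<subseteq> {..<n} \<Longrightarrow>
      holds M e \<psi> = (\<forall>\<^sub>F i in U. holds M (\<beta> i \<circ> inv_into I f) \<psi>)"
    using ex_assignment_realising_limit[OF sat \<kappa> X, of n "\<lambda>i. \<beta> i \<circ> inv_into I f"] by blast
  have "realises_limit L M U I \<beta> X (e \<circ> f)"
    unfolding realises_limit_def
  proof (intro ballI allI impI)
    fix \<psi> :: "('f, 'r, 'm) fm" and \<tau> :: "nat \<Rightarrow> 'i"
    assume \<psi>: "\<psi> \<in> formulas L X" and \<tau>: "\<tau> ` fv \<psi> \<subseteq> I"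
    define \<theta> where "\<theta> y = (if \<tau> y \<in> I then Var (f (\<tau> y)) else Var (y + n) :: ('f, 'm) tm)" for y
    define \<chi> where "\<chi> = tr_fm (\<lambda>x. x + n) \<theta> Par \<psi>"
    have holds: "holds M e' \<chi> = holds M (e' \<circ> f \<circ> \<tau>) \<psi>" for e'
    proof -
      have "holds M e' \<chi> = holds M (\<lambda>y. eval_tm M e' (\<theta> y)) (inst_fm (\<lambda>a. eval_tm M e' (Par a)) \<psi>)"
        unfolding \<chi>_def
        by (rule sat_tr_fm) (auto simp: \<theta>_def inj_def dest!: f_less split: if_splits)
      also have "\<dots> = holds M (\<lambda>y. eval_tm M e' (\<theta> y)) \<psi>" by (simp add: inst_fm_id)
      also have "\<dots> = holds M (e' \<circ> f \<circ> \<tau>) \<psi>"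
        by (rule sat_cong) (use \<tau> in \<open>auto simp: \<theta>_def\<close>)
      finally show ?thesis .
    qed
    have "wf_fm L \<chi>"
      unfolding \<chi>_def by (rule wf_tr_fm) (use \<psi> in \<open>auto simp: formulas_def \<theta>_def\<close>)
    moreover have "pars_fm \<chi> \<subseteq> X"
      using pars_tr_fm[of "\<lambda>x. x + n" \<theta> Par \<psi>] \<psi> unfolding \<chi>_def
      by (auto simp: formulas_def \<theta>_def split: if_splits)
    moreover have "fv \<chi> \<subseteq> {..<n}"
    proof
      fix x assume "x \<in> fv \<chi>"
      then obtain y where "y \<in> fv \<psi>" "x \<in> fv_tm (\<theta> y)"
        using fv_tr_fm[of "\<lambda>x. x + n" \<theta> Par \<psi>] unfolding \<chi>_def by auto
      then show "x \<in> {..<n}" using \<tau> f_less by (auto simp: \<theta>_def)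
    qed
    ultimately have "holds M e \<chi> = (\<forall>\<^sub>F i in U. holds M (\<beta> i \<circ> inv_into I f) \<chi>)"
      by (intro e) (auto simp: formulas_def)
    moreover have "holds M (\<beta> i \<circ> inv_into I f) \<chi> = holds M (\<beta> i \<circ> \<tau>) \<psi>" for i
      unfolding holds by (rule sat_cong) (use \<tau> f_inv in auto)
    ultimately show "holds M (e \<circ> f \<circ> \<tau>) \<psi> = (\<forall>\<^sub>F i in U. holds M (\<beta> i \<circ> \<tau>) \<psi>)"
      by (simp add: holds)
  qed
  then show ?thesis by blast
qed

lemma (in ultrafilter) ex_sequence_realising_limit:
  assumes sat: "saturated L M \<kappa>" and \<kappa>: "Card_order \<kappa>" "natLeq <o \<kappa>" and X: "small \<kappa> X" and I: "finite I"
    and \<gamma>0: "realises_limit L M U I \<beta> X \<gamma>0"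
  shows "\<exists>\<gamma>. \<gamma> 0 = \<gamma>0 \<and> (\<forall>j :: nat. realises_limit L M U I \<beta> (X \<union> (\<Union>i<j. \<gamma> i ` I)) (\<gamma> j))"
proof -
  define Q where "Q = (\<lambda>s s'. fst s' = fst s \<union> snd s ` I \<and> realises_limit L M U I \<beta> (fst s') (snd s'))"
  have "\<exists>f. \<forall>j :: nat. ((j = 0 \<longrightarrow> f j = (X, \<gamma>0)) \<and> small \<kappa> (fst (f j))) \<and> Q (f j) (f (Suc j))"
  proof (rule dependent_nat_choice)
    show "\<exists>s. (0 = 0 \<longrightarrow> s = (X, \<gamma>0)) \<and> small \<kappa> (fst s)" using X by auto
  next
    fix s and j :: nat assume "(j = 0 \<longrightarrow> s = (X, \<gamma>0)) \<and> small \<kappa> (fst s)"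
    then have small: "small \<kappa> (fst s \<union> snd s ` I)"
      by (intro small_Un[OF \<kappa>] small_finite[OF \<kappa>(2), of "snd s ` I"]) (auto simp: I)
    from ex_realises_limit[OF sat \<kappa> this I, of \<beta>]
    obtain \<gamma> where "realises_limit L M U I \<beta> (fst s \<union> snd s ` I) \<gamma>" by blast
    then show "\<exists>s'. ((Suc j = 0 \<longrightarrow> s' = (X, \<gamma>0)) \<and> small \<kappa> (fst s')) \<and> Q s s'"
      using small by (intro exI[of _ "(fst s \<union> snd s ` I, \<gamma>)"]) (simp add: Q_def)
  qed
  then obtain f where f: "f 0 = (X, \<gamma>0)" "\<And>j. Q (f j) (f (Suc j))" by auto
  have fst: "fst (f j) = X \<union> (\<Union>i<j. snd (f i) ` I)" for j
    by (induction j) (use f in \<open>auto simp: Q_def lessThan_Suc\<close>)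
  have "realises_limit L M U I \<beta> (fst (f j)) (snd (f j))" for j
  proof (cases j)
    case (Suc i)
    then show ?thesis using f(2)[of i] unfolding Q_def by blast
  qed (simp add: f(1) \<gamma>0)
  then show ?thesis
    using f(1) unfolding fst by (intro exI[of _ "\<lambda>j. snd (f j)"]) simp
qed

lemma ex_joint_satisfiability_formula:
  fixes M :: "('f, 'r, 'm) struct" and \<phi> :: "('f, 'r, 'm) fm"
  assumes \<chi>: "\<chi> \<in> formulas L X" and \<phi>: "wf_fm L \<phi>"
  shows "\<exists>\<Theta>\<in>formulas L X. \<exists>\<tau>. \<tau> ` fv \<Theta> \<subseteq> pars_fm \<phi> \<and>
    (\<forall>\<delta>. holds M (\<delta> \<circ> \<tau>) \<Theta> \<longleftrightarrow> (\<exists>e. holds M e \<chi> \<and> holds M e (inst_fm \<delta> \<phi>)))"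
proof -
  define P where "P = pars_fm \<phi>"
  obtain f n where f: "bij_betw f P {0..<n :: nat}"
    using ex_bij_betw_finite_nat[of P] finite_pars_fm unfolding P_def by blast
  have f_less: "f p < n" if "p \<in> P" for p using f that by (auto simp: bij_betw_def)
  define \<tau> where "\<tau> = inv_into P f"
  have \<tau>: "\<tau> (f p) = p" if "p \<in> P" for p
    using f that by (auto simp: bij_betw_def \<tau>_def)
  define s where "s = (\<lambda>x. x + n)"
  define \<theta> where "\<theta> y = (Var (s y) :: ('f, 'm) tm)" for y
  define \<rho> where "\<rho> a = (if a \<in> P then Var (f a) else Par a :: ('f, 'm) tm)" for a
  define \<chi>' where "\<chi>' = tr_fm s \<theta> Par \<chi>"
  define \<phi>' where "\<phi>' = tr_fm s \<theta> \<rho> \<phi>"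
  have \<chi>'_holds: "holds M e \<chi>' = holds M (e \<circ> s) \<chi>" for e
  proof -
    have "holds M e \<chi>' = holds M (\<lambda>y. eval_tm M e (\<theta> y)) (inst_fm (\<lambda>a. eval_tm M e (Par a)) \<chi>)"
      unfolding \<chi>'_def by (rule sat_tr_fm) (auto simp: \<theta>_def s_def inj_def)
    then show ?thesis by (simp add: inst_fm_id \<theta>_def comp_def)
  qed
  have \<phi>'_holds: "holds M e \<phi>' = holds M (e \<circ> s) (inst_fm \<delta> \<phi>)"
    if "\<And>p. p \<in> P \<Longrightarrow> e (f p) = \<delta> p" for e \<delta>
  proof -
    have "holds M e \<phi>' = holds M (\<lambda>y. eval_tm M e (\<theta> y)) (inst_fm (\<lambda>a. eval_tm M e (\<rho> a)) \<phi>)"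
      unfolding \<phi>'_def by (rule sat_tr_fm) (auto simp: \<theta>_def \<rho>_def s_def inj_def dest!: f_less)
    also have "inst_fm (\<lambda>a. eval_tm M e (\<rho> a)) \<phi> = inst_fm \<delta> \<phi>"
      by (rule fm.map_cong) (use that in \<open>auto simp: \<rho>_def P_def\<close>)
    finally show ?thesis by (simp add: \<theta>_def comp_def)
  qed
  obtain xs where xs: "set xs = s ` (fv \<chi> \<union> fv \<phi>)"
    using finite_list[of "s ` (fv \<chi> \<union> fv \<phi>)"] finite_fv by blast
  have f_xs: "f p \<notin> set xs" if "p \<in> P" for p
    using f_less[OF that] unfolding xs s_def by auto
  define \<Theta> where "\<Theta> = foldr Ex xs (Conj \<chi>' \<phi>')"
  have "wf_fm L \<chi>'" "wf_fm L \<phi>'"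
    unfolding \<chi>'_def \<phi>'_def
    by (rule wf_tr_fm; use \<chi> \<phi> in \<open>simp add: formulas_def \<theta>_def \<rho>_def\<close>)+
  moreover have "pars_fm \<chi>' \<subseteq> X" "pars_fm \<phi>' \<subseteq> X"
    using pars_tr_fm[of s \<theta> Par \<chi>] pars_tr_fm[of s \<theta> \<rho> \<phi>] \<chi>
    unfolding \<chi>'_def \<phi>'_def by (auto simp: formulas_def \<theta>_def \<rho>_def P_def split: if_splits)
  ultimately have "\<Theta> \<in> formulas L X"
    unfolding \<Theta>_def foldr_Ex_in_formulas by (simp add: formulas_def)
  moreover have "\<tau> ` fv \<Theta> \<subseteq> P"
  proof -
    have "fv \<chi>' \<subseteq> set xs"
      using fv_tr_fm[of s \<theta> Par \<chi>] unfolding \<chi>'_def xs by (auto simp: \<theta>_def)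
    moreover have "fv \<phi>' \<subseteq> set xs \<union> f ` P"
      using fv_tr_fm[of s \<theta> \<rho> \<phi>] unfolding \<phi>'_def xs by (auto simp: \<theta>_def \<rho>_def P_def)
    ultimately have "fv \<Theta> \<subseteq> f ` P" unfolding \<Theta>_def fv_foldr_Ex by auto
    then show ?thesis using \<tau> by auto
  qed
  moreover have "holds M (\<delta> \<circ> \<tau>) \<Theta> \<longleftrightarrow> (\<exists>e. holds M e \<chi> \<and> holds M e (inst_fm \<delta> \<phi>))" for \<delta>
  proof
    assume "holds M (\<delta> \<circ> \<tau>) \<Theta>"
    then obtain e' where e': "\<And>y. y \<notin> set xs \<Longrightarrow> e' y = (\<delta> \<circ> \<tau>) y" "holds M e' \<chi>'" "holds M e' \<phi>'"
      unfolding \<Theta>_def sat_foldr_Ex by auto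
    have "e' (f p) = \<delta> p" if "p \<in> P" for p
      using e'(1)[OF f_xs[OF that]] \<tau>[OF that] by simp
    then show "\<exists>e. holds M e \<chi> \<and> holds M e (inst_fm \<delta> \<phi>)"
      using e'(2,3) \<phi>'_holds[of e' \<delta>] by (auto simp: \<chi>'_holds)
  next
    assume "\<exists>e. holds M e \<chi> \<and> holds M e (inst_fm \<delta> \<phi>)"
    then obtain e where e: "holds M e \<chi>" "holds M e (inst_fm \<delta> \<phi>)" by blast
    define e' where "e' y = (if y \<in> set xs then e (y - n) else \<delta> (\<tau> y))" for y
    have "e' (f p) = \<delta> p" if "p \<in> P" for p
      using f_xs[OF that] \<tau>[OF that] by (simp add: e'_def)
    moreover have "holds M (e' \<circ> s) \<chi> = holds M e \<chi>"
      by (rule sat_cong) (auto simp: e'_def xs s_def)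
    moreover have "holds M (e' \<circ> s) (inst_fm \<delta> \<phi>) = holds M e (inst_fm \<delta> \<phi>)"
      by (rule sat_cong) (auto simp: e'_def xs s_def fv_inst_fm)
    ultimately have "holds M e' (Conj \<chi>' \<phi>')"
      using e \<phi>'_holds[of e' \<delta>] by (simp add: \<chi>'_holds)
    then show "holds M (\<delta> \<circ> \<tau>) \<Theta>"
      unfolding \<Theta>_def sat_foldr_Ex by (intro exI[of _ e']) (simp add: e'_def)
  qed
  ultimately show ?thesis unfolding P_def by blast
qed

lemma realises_limit_joint_satisfiability:
  fixes M :: "('f, 'r, 'm) struct" and \<phi> :: "('f, 'r, 'm) fm"
  assumes lim: "realises_limit L M U (pars_fm \<phi>) \<beta> X \<gamma>"
    and \<chi>: "\<chi> \<in> formulas L X" and \<phi>: "wf_fm L \<phi>"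
    and e: "holds M e \<chi>" "holds M e (inst_fm \<gamma> \<phi>)"
  shows "\<forall>\<^sub>F i in U. \<exists>e. holds M e \<chi> \<and> holds M e (inst_fm (\<beta> i) \<phi>)"
proof -
  obtain \<Theta> \<tau> where \<Theta>: "\<Theta> \<in> formulas L X" "\<tau> ` fv \<Theta> \<subseteq> pars_fm \<phi>"
    "\<And>\<delta>. holds M (\<delta> \<circ> \<tau>) \<Theta> \<longleftrightarrow> (\<exists>e. holds M e \<chi> \<and> holds M e (inst_fm \<delta> \<phi>))"
    using ex_joint_satisfiability_formula[OF \<chi> \<phi>, of M] by blast
  show ?thesis using realises_limitD[OF lim \<Theta>(1,2)] e unfolding \<Theta>(3) by blast
qed

text \<open>
  A common solution of \<open>k\<close> conjugates along the sequence is pulled back, one conjugate at a time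
  and the last one first, to a common solution of \<open>k\<close> of the formulas with parameters \<open>\<beta> i\<close>.
\<close>

lemma realises_limit_sequence_consistent:
  fixes M :: "('f, 'r, 'm) struct" and \<phi> :: "('f, 'r, 'm) fm"
  assumes U: "U \<le> sequentially" "U \<noteq> bot"
    and lim: "\<And>j. realises_limit L M U (pars_fm \<phi>) \<beta> (N \<union> (\<Union>i<j. \<gamma> i ` pars_fm \<phi>)) (\<gamma> j)"
    and \<beta>: "\<And>i. \<beta> i ` pars_fm \<phi> \<subseteq> N" and \<phi>: "wf_fm L \<phi>"
    and e: "\<And>j. j < k \<Longrightarrow> holds M e (inst_fm (\<gamma> j) \<phi>)"
  shows "\<exists>S. finite S \<and> card S = k \<and> (\<exists>e. \<forall>i\<in>S. holds M e (inst_fm (\<beta> i) \<phi>))"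
proof -
  have "m \<le> k \<Longrightarrow> \<exists>S. finite S \<and> card S = m \<and> (\<exists>e. (\<forall>j<k - m. holds M e (inst_fm (\<gamma> j) \<phi>)) \<and>
      (\<forall>i\<in>S. holds M e (inst_fm (\<beta> i) \<phi>)))" for m
  proof (induction m)
    case 0
    show ?case using e by (intro exI[of _ "{}"]) auto
  next
    case (Suc m)
    then obtain S e' where S: "finite S" "card S = m"
      "\<And>j. j < k - m \<Longrightarrow> holds M e' (inst_fm (\<gamma> j) \<phi>)" "\<And>i. i \<in> S \<Longrightarrow> holds M e' (inst_fm (\<beta> i) \<phi>)"
      by auto
    define j where "j = k - Suc m"
    have j: "k - m = Suc j" using Suc.prems by (simp add: j_def)
    let ?X = "N \<union> (\<Union>i<j. \<gamma> i ` pars_fm \<phi>)"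
    let ?\<Psi> = "(\<lambda>l. inst_fm (\<gamma> l) \<phi>) ` {..<j} \<union> (\<lambda>i. inst_fm (\<beta> i) \<phi>) ` S"
    have \<phi>': "\<phi> \<in> formulas L (pars_fm \<phi>)" using \<phi> by (simp add: formulas_def)
    have "inst_fm (\<gamma> l) \<phi> \<in> formulas L ?X" if "l < j" for l
      by (rule inst_fm_in_formulas[OF \<phi>']) (use that in auto)
    moreover have "inst_fm (\<beta> i) \<phi> \<in> formulas L ?X" for i
      by (rule inst_fm_in_formulas[OF \<phi>']) (use \<beta> in blast)
    ultimately have sub: "?\<Psi> \<subseteq> formulas L ?X" by auto
    have "finite ?\<Psi>" using S(1) by simp
    from ex_finite_conj[OF this sub] obtain \<chi>
      where \<chi>: "\<chi> \<in> formulas L ?X" "\<And>e. holds M e \<chi> \<longleftrightarrow> (\<forall>\<psi>\<in>?\<Psi>. holds M e \<psi>)"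
      by (elim bexE conjE) metis
    have "holds M e' \<chi>" unfolding \<chi>(2) using S(3,4) j by auto
    moreover have "holds M e' (inst_fm (\<gamma> j) \<phi>)" using S(3) j by simp
    ultimately have "\<forall>\<^sub>F i in U. \<exists>e. holds M e \<chi> \<and> holds M e (inst_fm (\<beta> i) \<phi>)"
      by (rule realises_limit_joint_satisfiability[OF lim \<chi>(1) \<phi>])
    moreover have "\<forall>\<^sub>F i in U. i \<notin> S"
    proof -
      obtain b where "\<And>i. i \<in> S \<Longrightarrow> i < b"
        using finite_nat_set_iff_bounded[of S] S(1) by blast
      then have "\<forall>\<^sub>F i in sequentially. i \<notin> S"
        unfolding eventually_sequentially by (intro exI[of _ b]) (meson not_less)
      then show ?thesis using U(1) by (simp add: le_filter_def)
    qed
    ultimately have "\<forall>\<^sub>F i in U. (\<exists>e. holds M e \<chi> \<and> holds M e (inst_fm (\<beta> i) \<phi>)) \<and> i \<notin> S"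
      by (rule eventually_conj)
    then obtain i e where "i \<notin> S" "holds M e \<chi>" "holds M e (inst_fm (\<beta> i) \<phi>)"
      using eventually_happens'[OF U(2)] by blast
    then show ?case using S(1,2)
      by (intro exI[of _ "insert i S"]) (auto simp: \<chi>(2) simp flip: j_def intro!: exI[of _ e])
  qed
  from this[of k] show ?thesis by auto
qed

section \<open>Coheir sequences and amalgamation\<close>

lemma small_model_automorphism:
  assumes N: "small_model L M \<kappa> N" and h: "automorphism L M h"
  shows "small_model L M \<kappa> (h ` N)"
proof -
  have b: "bij h" using h by (rule automorphism_bij)
  have inj: "inv h (h x) = x" and surj: "h (inv h x) = x" for x
    using b by (simp_all add: bij_is_inj bij_is_surj surj_f_inv_f)
  have pull: "inv h x \<in> N" if "x \<in> h ` N" for x using that inj by auto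
  have "small \<kappa> (h ` N)" "h ` N \<noteq> {}" using N by (auto simp: small_model_def small_image)
  moreover have "fun_of M f xs \<in> h ` N" if "(f, length xs) \<in> Funs L" "set xs \<subseteq> h ` N" for f xs
  proof -
    let ?ys = "map (inv h) xs"
    have "set ?ys \<subseteq> N" using that(2) pull by auto
    moreover have "(f, length ?ys) \<in> Funs L" using that(1) by simp
    ultimately have "fun_of M f ?ys \<in> N" using N unfolding small_model_def by blast
    moreover have "h (fun_of M f ?ys) = fun_of M f (map h ?ys)"
      by (rule automorphism_fun[OF h]) (simp add: that(1))
    moreover have "map h ?ys = xs" by (simp add: surj map_idI)
    ultimately show ?thesis by (metis image_eqI)
  qed
  moreover have "sat (h ` N) M e \<phi> = holds M e \<phi>" if "\<phi> \<in> formulas L {}" "range e \<subseteq> h ` N" for \<phi> e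
  proof -
    have e: "h \<circ> (inv h \<circ> e) = e" using surj by auto
    have "range (inv h \<circ> e) \<subseteq> N" using that(2) pull by auto
    then have "sat N M (inv h \<circ> e) \<phi> = holds M (inv h \<circ> e) \<phi>"
      using N that(1) unfolding small_model_def by blast
    moreover have "inst_fm h \<phi> = \<phi>" by (rule inst_fm_fixed) (use that(1) in \<open>auto simp: formulas_def\<close>)
    ultimately show ?thesis
      using automorphism_sat[OF h, of \<phi> N "inv h \<circ> e"] automorphism_holds[OF h, of \<phi> "inv h \<circ> e"] that(1)
      by (simp add: formulas_def e)
  qed
  ultimately show ?thesis unfolding small_model_def by blast
qed

text \<open>
  The sequence is a Morley sequence of a global type finitely satisfiable in \<open>N\<close>: the limit of the
  types of the dividing sequence along an ultrafilter. Neither indiscernibility nor Ramsey's theorem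
  is needed, as only a common type over \<open>N\<close> and coheir independence enter the amalgamation.
\<close>

lemma dividing_coheir_sequence:
  fixes L :: "('f, 'r) lang" and T :: "('f, 'r, 'm) fm set"
    and M :: "('f, 'r, 'm) struct" and \<kappa> :: "'k rel"
  assumes mon: "monster_model L T M \<kappa>" and C: "small \<kappa> C" and \<phi>: "wf_fm L (\<phi> :: ('f, 'r, 'm) fm)"
    and div: "formula_divides L M C \<phi>"
  shows "\<exists>N (\<gamma> :: nat \<Rightarrow> 'm \<Rightarrow> 'm) k. small_model L M \<kappa> N \<and> C \<subseteq> N \<and> (\<forall>p\<in>pars_fm \<phi>. \<gamma> 0 p = p) \<and>
     (\<forall>j. tp L M (pars_fm \<phi>) (\<gamma> j) N = tp L M (pars_fm \<phi>) id N) \<and>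
     (\<forall>j. indep_h L M (\<gamma> j ` pars_fm \<phi>) N (\<Union>i<j. \<gamma> i ` pars_fm \<phi>)) \<and>
     \<not> (\<exists>e. \<forall>j<k. holds M e (inst_fm (\<gamma> j) \<phi>))"
proof -
  define P where "P = pars_fm \<phi>"
  have P: "finite P" by (simp add: P_def finite_pars_fm)
  have \<kappa>: "Card_order \<kappa>" "natLeq <o \<kappa>" and sat: "saturated L M \<kappa>" and hom: "strongly_homogeneous L M \<kappa>"
    using mon by (auto simp: monster_model_def)
  obtain k and \<beta> :: "nat \<Rightarrow> 'm \<Rightarrow> 'm" where \<beta>: "\<And>i. tp L M P (\<beta> i) C = tp L M P id C"
    and incons: "\<And>S. finite S \<Longrightarrow> card S = k \<Longrightarrow> \<not> (\<exists>e. \<forall>i\<in>S. holds M e (inst_fm (\<beta> i) \<phi>))"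
    using div unfolding formula_divides_def P_def[symmetric]
    by (elim exE conjE) (rule that, erule spec, drule spec, erule mp, rule conjI)
  obtain U :: "nat filter" where U: "U \<le> sequentially" "U \<noteq> bot"
    "\<And>Q. eventually Q U \<or> eventually (\<lambda>i. \<not> Q i) U"
    using ex_nonprincipal_ultrafilter by blast
  interpret ultrafilter U by standard (use U in auto)
  have "small \<kappa> (C \<union> (\<Union>i. \<beta> i ` P))"
    by (intro small_Un \<kappa> C small_UN_nat_finite) (simp add: P)
  from ex_small_model[OF mon this] obtain N0
    where N0: "C \<union> (\<Union>i. \<beta> i ` P) \<subseteq> N0" "small_model L M \<kappa> N0" by blast
  have smallN0: "small \<kappa> N0" using N0(2) by (simp add: small_model_def)
  obtain \<gamma>0 where \<gamma>0: "realises_limit L M U P \<beta> N0 \<gamma>0"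
    using ex_realises_limit[OF sat \<kappa> smallN0 P, of \<beta>] by blast
  have tp: "tp L M P \<gamma>0 C = tp L M P id C"
  proof (rule tp_eqI)
    fix \<psi> :: "('f, 'r, 'm) fm" and \<tau> assume \<psi>: "\<psi> \<in> formulas L C" "\<tau> ` fv \<psi> \<subseteq> P"
    have "\<psi> \<in> formulas L N0" using \<psi>(1) N0(1) formulas_mono[of C N0 L] by auto
    then have "holds M (\<gamma>0 \<circ> \<tau>) \<psi> = (\<forall>\<^sub>F i in U. holds M (\<beta> i \<circ> \<tau>) \<psi>)"
      by (rule realises_limitD[OF \<gamma>0 _ \<psi>(2)])
    then show "holds M (\<gamma>0 \<circ> \<tau>) \<psi> = holds M (id \<circ> \<tau>) \<psi>"
      using U(2) by (simp add: tp_eqD[OF \<beta> \<psi>])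
  qed
  have "small \<kappa> (P \<union> C)" by (intro small_Un \<kappa> C small_finite P)
  from ex_automorphism_over[OF hom this tp] obtain h
    where h: "automorphism L M h" "\<And>c. c \<in> C \<Longrightarrow> h c = c" "\<And>p. p \<in> P \<Longrightarrow> h p = \<gamma>0 p" by blast
  define g where "g = inv h"
  have gh: "g (h x) = x" and hg: "h (g x) = x" for x
    using automorphism_bij[OF h(1)] by (simp_all add: g_def bij_is_inj bij_is_surj surj_f_inv_f)
  have g: "automorphism L M g" unfolding g_def by (rule automorphism_inv[OF h(1)])
  define N where "N = g ` N0"
  have N: "small_model L M \<kappa> N" unfolding N_def by (rule small_model_automorphism[OF N0(2) g])
  have "C \<subseteq> N"
  proof
    fix c assume c: "c \<in> C"
    then have "g c = c" using gh[of c] h(2) by simp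
    then show "c \<in> N" using c N0(1) unfolding N_def by (metis UnI1 image_eqI subsetD)
  qed
  have \<beta>N: "(g \<circ> \<beta> i) ` P \<subseteq> N" for i
    using N0(1) unfolding N_def image_comp[symmetric] by (intro image_mono) blast
  have "realises_limit L M U P (\<lambda>i. g \<circ> \<beta> i) N (g \<circ> \<gamma>0)"
    unfolding N_def by (rule realises_limit_automorphism[OF g \<gamma>0])
  then have id: "realises_limit L M U P (\<lambda>i. g \<circ> \<beta> i) N id"
    by (rule realises_limit_cong) (simp add: gh flip: h(3))
  have "small \<kappa> N" using N by (simp add: small_model_def)
  from ex_sequence_realising_limit[OF sat \<kappa> this P id] obtain \<gamma> :: "nat \<Rightarrow> 'm \<Rightarrow> 'm"
    where \<gamma>: "\<gamma> 0 = id"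
    "\<And>j. realises_limit L M U P (\<lambda>i. g \<circ> \<beta> i) (N \<union> (\<Union>i<j. \<gamma> i ` P)) (\<gamma> j)" by blast
  have "tp L M P (\<gamma> j) N = tp L M P id N" for j
    by (rule realises_limit_tp_eq[OF realises_limit_antimono[OF \<gamma>(2)] id]) simp
  moreover have "indep_h L M (\<gamma> j ` P) N (\<Union>i<j. \<gamma> i ` P)" for j
    by (rule realises_limit_indep_h[OF \<gamma>(2) U(2) \<beta>N]) auto
  moreover have "\<not> (\<exists>e. \<forall>j<k. holds M e (inst_fm (\<gamma> j) \<phi>))"
  proof
    assume "\<exists>e. \<forall>j<k. holds M e (inst_fm (\<gamma> j) \<phi>)"
    then obtain e where e: "\<And>j. j < k \<Longrightarrow> holds M e (inst_fm (\<gamma> j) \<phi>)" by blast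
    have "\<exists>S. finite S \<and> card S = k \<and> (\<exists>e. \<forall>i\<in>S. holds M e (inst_fm (g \<circ> \<beta> i) \<phi>))"
      by (rule realises_limit_sequence_consistent[where \<beta> = "\<lambda>i. g \<circ> \<beta> i" and \<gamma> = \<gamma> and N = N,
            OF U(1,2) \<gamma>(2)[unfolded P_def] \<beta>N[unfolded P_def] \<phi> e])
    then obtain S e' where S: "finite S" "card S = k"
      and e': "\<And>i. i \<in> S \<Longrightarrow> holds M e' (inst_fm (g \<circ> \<beta> i) \<phi>)" by blast
    have "holds M (h \<circ> e') (inst_fm (\<beta> i) \<phi>)" if "i \<in> S" for i
    proof -
      have "inst_fm h (inst_fm (g \<circ> \<beta> i) \<phi>) = inst_fm (\<beta> i) \<phi>"
        by (simp add: inst_fm_inst_fm hg)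
      then show ?thesis
        using automorphism_holds[OF h(1), of "inst_fm (g \<circ> \<beta> i) \<phi>" e'] e'[OF that] \<phi>
        by (simp add: wf_inst_fm)
    qed
    then show False using incons[OF S] by blast
  qed
  ultimately show ?thesis using N \<open>C \<subseteq> N\<close> \<gamma>(1) unfolding P_def
    by (intro exI[of _ N] exI[of _ \<gamma>] exI[of _ k]) auto
qed

lemma coheir_sequence_amalgamation:
  fixes M :: "('f, 'r, 'm) struct" and \<kappa> :: "'k rel" and c0 :: "'k \<Rightarrow> 'm" and \<gamma> :: "nat \<Rightarrow> 'm \<Rightarrow> 'm"
  assumes mon: "monster_model L T M \<kappa>" and inv: "invariant L M \<kappa> R"
    and amalg: "h_amalgamation_over_models L M \<kappa> R"
    and N: "small_model L M \<kappa> N" and \<phi>: "wf_fm L (\<phi> :: ('f, 'r, 'm) fm)"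
    and \<gamma>0: "\<And>p. p \<in> pars_fm \<phi> \<Longrightarrow> \<gamma> 0 p = p"
    and tp: "\<And>j. tp L M (pars_fm \<phi>) (\<gamma> j) N = tp L M (pars_fm \<phi>) id N"
    and coheir: "\<And>j. indep_h L M (\<gamma> j ` pars_fm \<phi>) N (\<Union>i<j. \<gamma> i ` pars_fm \<phi>)"
    and I: "small \<kappa> I" and c0: "R (c0 ` I) N (pars_fm \<phi>)" "\<rho> ` fv \<phi> \<subseteq> I" "holds M (c0 \<circ> \<rho>) \<phi>"
  shows "\<exists>c. tp L M I c N = tp L M I c0 N \<and> R (c ` I) N (\<Union>i<Suc j. \<gamma> i ` pars_fm \<phi>) \<and>
    (\<forall>i<Suc j. holds M (c \<circ> \<rho>) (inst_fm (\<gamma> i) \<phi>))"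
proof (induction j)
  case 0
  have "\<gamma> 0 ` pars_fm \<phi> = pars_fm \<phi>" using \<gamma>0 by auto
  moreover have "inst_fm (\<gamma> 0) \<phi> = \<phi>" by (rule inst_fm_fixed[OF \<gamma>0])
  ultimately show ?case using c0 by (intro exI[of _ c0]) (simp add: lessThan_Suc comp_def)
next
  case (Suc j)
  define P where "P = pars_fm \<phi>"
  define B where "B = (\<Union>i<Suc j. \<gamma> i ` P)"
  have \<kappa>: "Card_order \<kappa>" "natLeq <o \<kappa>" and hom: "strongly_homogeneous L M \<kappa>"
    using mon by (auto simp: monster_model_def)
  have P: "finite P" by (simp add: P_def finite_pars_fm)
  have smallP: "small \<kappa> P" by (intro small_finite \<kappa> P)
  have smallN: "small \<kappa> N" using N by (simp add: small_model_def)
  obtain c where c: "tp L M I c N = tp L M I c0 N" "R (c ` I) N B"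
    "\<And>i. i < Suc j \<Longrightarrow> holds M (c \<circ> \<rho>) (inst_fm (\<gamma> i) \<phi>)"
    using Suc.IH unfolding B_def P_def by blast
  from ex_automorphism_over[OF hom small_Un[OF \<kappa> smallP smallN] tp[of "Suc j", folded P_def]] obtain h
    where h: "automorphism L M h" "\<And>x. x \<in> N \<Longrightarrow> h x = x" "\<And>p. p \<in> P \<Longrightarrow> h p = \<gamma> (Suc j) p" by blast
  define A where "A = \<gamma> (Suc j) ` P"
  have hP: "h ` P = A" and hN: "h ` N = N" using h(2,3) by (auto simp: A_def)
  have "triple_equiv L M (c0 ` I) P N (h ` c0 ` I) A N"
    using automorphism_triple_equiv[OF h(1), of "c0 ` I" P N] by (simp add: hP hN)
  then have "R (h ` c0 ` I) N A"
    using inv small_image[OF I] smallP smallN c0(1) unfolding invariant_def P_def by blast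
  then have R1: "R ((h \<circ> c0) ` I) N A" by (simp add: image_comp)
  have tp1: "tp L M I (h \<circ> c0) N = tp L M I c N"
    using automorphism_tp[OF h(1,2)] c(1) by simp
  have "small \<kappa> A" "small \<kappa> B" unfolding A_def B_def using P by (auto intro!: small_finite \<kappa>)
  moreover have "indep_h L M A N B" using coheir[of "Suc j"] by (simp add: A_def B_def P_def)
  ultimately obtain c' where c': "R (c' ` I) N (A \<union> B)"
    "tp L M I c' (N \<union> A) = tp L M I (h \<circ> c0) (N \<union> A)" "tp L M I c' (N \<union> B) = tp L M I c (N \<union> B)"
    using amalg N I tp1 R1 c(2) unfolding h_amalgamation_over_models_def by blast
  have \<phi>': "\<phi> \<in> formulas L P" using \<phi> by (simp add: formulas_def P_def)
  have "A \<union> B = (\<Union>i<Suc (Suc j). \<gamma> i ` P)" by (simp add: A_def B_def lessThan_Suc)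
  moreover have "tp L M I c' N = tp L M I c0 N"
    using tp_eq_antimono[OF c'(3) subset_refl, of N] c(1) by simp
  moreover have "holds M (c' \<circ> \<rho>) (inst_fm (\<gamma> i) \<phi>)" if i: "i < Suc (Suc j)" for i
  proof (cases "i = Suc j")
    case True
    have "inst_fm (\<gamma> i) \<phi> \<in> formulas L (N \<union> A)"
      by (rule inst_fm_in_formulas[OF \<phi>']) (auto simp: True A_def P_def)
    then have "holds M (c' \<circ> \<rho>) (inst_fm (\<gamma> i) \<phi>) = holds M (h \<circ> c0 \<circ> \<rho>) (inst_fm (\<gamma> i) \<phi>)"
      by (intro tp_eqD[OF c'(2)]) (simp_all add: fv_inst_fm c0(2))
    moreover have "inst_fm (\<gamma> i) \<phi> = inst_fm h \<phi>"
      by (rule fm.map_cong) (simp_all add: True h(3) P_def)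
    ultimately show ?thesis
      using automorphism_holds[OF h(1) \<phi>, of "c0 \<circ> \<rho>"] c0(3) by (simp add: comp_assoc)
  next
    case False
    then have i: "i < Suc j" using i by simp
    then have "inst_fm (\<gamma> i) \<phi> \<in> formulas L (N \<union> B)"
      by (intro inst_fm_in_formulas[OF \<phi>']) (auto simp: B_def P_def)
    then have "holds M (c' \<circ> \<rho>) (inst_fm (\<gamma> i) \<phi>) = holds M (c \<circ> \<rho>) (inst_fm (\<gamma> i) \<phi>)"
      by (intro tp_eqD[OF c'(3)]) (simp_all add: fv_inst_fm c0(2))
    then show ?thesis using c(3)[OF i] by simp
  qed
  ultimately show ?case using c'(1) unfolding P_def by (intro exI[of _ c']) (simp add: comp_def)
qed

lemma monotonise_imp_indep_d:
  fixes L :: "('f, 'r) lang" and T :: "('f, 'r, 'm) fm set"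
    and M :: "('f, 'r, 'm) struct" and \<kappa> :: "'k rel" and R :: "'m indep"
  assumes mon: "monster_model L T M \<kappa>" and inv: "invariant L M \<kappa> R" and right: "right_monotone \<kappa> R"
    and amalg: "h_amalgamation_over_models L M \<kappa> R" and ext: "has_extension L M \<kappa> (monotonise R)"
    and small: "small \<kappa> A" "small \<kappa> B" "small \<kappa> C" and R: "monotonise R A C B"
  shows "indep_d L M A C B"
  unfolding indep_d_def
proof clarify
  fix \<phi> \<sigma>
  assume tp: "(\<phi>, \<sigma>) \<in> tp L M A id (B \<union> C)" and div: "formula_divides L M C \<phi>"
  have \<phi>: "wf_fm L \<phi>" "pars_fm \<phi> \<subseteq> B \<union> C" "\<sigma> ` fv \<phi> \<subseteq> A"
    using tp by (auto simp: tp_def formulas_def)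
  have \<kappa>: "Card_order \<kappa>" "natLeq <o \<kappa>" using mon by (auto simp: monster_model_def)
  obtain N \<gamma> k where N: "small_model L M \<kappa> N" "C \<subseteq> N" and \<gamma>0: "\<And>p. p \<in> pars_fm \<phi> \<Longrightarrow> \<gamma> 0 p = p"
    and \<gamma>: "\<And>j :: nat. tp L M (pars_fm \<phi>) (\<gamma> j) N = tp L M (pars_fm \<phi>) id N"
      "\<And>j. indep_h L M (\<gamma> j ` pars_fm \<phi>) N (\<Union>i<j. \<gamma> i ` pars_fm \<phi>)"
    and incons: "\<not> (\<exists>e. \<forall>j<k. holds M e (inst_fm (\<gamma> j) \<phi>))"
    using dividing_coheir_sequence[OF mon small(3) \<phi>(1) div] by blast
  have smallN: "small \<kappa> N" using N(1) by (simp add: small_model_def)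
  have smallBN: "small \<kappa> (B \<union> N)" by (intro small_Un \<kappa> small smallN)
  obtain A' where A': "set_equiv L M (B \<union> C) A' A" "monotonise R A' C (B \<union> N)"
    using ext small smallBN R unfolding has_extension_def by blast
  then obtain g where g: "g ` A = A'" "tp L M A g (B \<union> C) = tp L M A id (B \<union> C)"
    unfolding set_equiv_def by blast
  have smallA': "small \<kappa> A'" unfolding g(1)[symmetric] by (rule small_image[OF small(1)])
  have g\<sigma>: "holds M (g \<circ> \<sigma>) \<phi>" using tp unfolding g(2)[symmetric] by (simp add: tp_def)
  have "R A' N (B \<union> N)" using A'(2) N(2) unfolding monotonise_def by blast
  moreover have "pars_fm \<phi> \<union> (B \<union> N) = B \<union> N" using \<phi>(2) N(2) by blast
  ultimately have RP: "R A' N (pars_fm \<phi>)"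
    using right smallA' smallN smallBN small_finite[OF \<kappa>(2) finite_pars_fm] unfolding right_monotone_def
    by metis
  have "|A'| \<le>o |Field \<kappa>|"
    using smallA' card_of_Field_ordIso[OF \<kappa>(1)] unfolding small_def
    by (metis ordIso_symmetric ordLeq_ordIso_trans ordLess_imp_ordLeq)
  then obtain f :: "'m \<Rightarrow> 'k" where f: "inj_on f A'" by (auto simp flip: card_of_ordLeq)
  define I where "I = f ` A'"
  define c0 where "c0 = inv_into A' f"
  define \<rho> where "\<rho> = f \<circ> g \<circ> \<sigma>"
  have c0: "c0 (f a) = a" if "a \<in> A'" for a using f that by (simp add: c0_def)
  have c0I: "c0 ` I = A'" using c0 by (auto simp: I_def image_iff)
  have \<rho>: "\<rho> ` fv \<phi> \<subseteq> I" using \<phi>(3) g(1) by (auto simp: \<rho>_def I_def)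
  have "holds M (c0 \<circ> \<rho>) \<phi> = holds M (g \<circ> \<sigma>) \<phi>"
    by (rule sat_cong) (use \<phi>(3) g(1) c0 in \<open>auto simp: \<rho>_def\<close>)
  then have "holds M (c0 \<circ> \<rho>) \<phi>" using g\<sigma> by simp
  with coheir_sequence_amalgamation[OF mon inv amalg N(1) \<phi>(1) \<gamma>0 \<gamma>, of I c0 \<rho> k] small_image[OF smallA'] RP \<rho> c0I
  obtain c where "\<And>i. i < Suc k \<Longrightarrow> holds M (c \<circ> \<rho>) (inst_fm (\<gamma> i) \<phi>)"
    unfolding I_def by metis
  then show False using incons by (meson less_Suc_eq)
qed

lemma indep_d_base_monotone:
  assumes "indep_d L M A C B" "C \<subseteq> D" "D \<subseteq> B \<union> C"
  shows "indep_d L M A D B"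
  unfolding indep_d_def
proof clarify
  fix \<phi> \<sigma> assume tp: "(\<phi>, \<sigma>) \<in> tp L M A id (B \<union> D)" and div: "formula_divides L M D \<phi>"
  have "formula_divides L M C \<phi>"
    using div tp_eq_antimono[OF _ subset_refl assms(2)] unfolding formula_divides_def by metis
  moreover have "B \<union> D = B \<union> C" using assms(2,3) by blast
  ultimately show False using assms(1) tp unfolding indep_d_def by (metis (mono_tags, lifting) case_prodI)
qed

lemma indep_d_imp_monotonise:
  assumes "Card_order \<kappa>" "natLeq <o \<kappa>" "stronger \<kappa> (indep_d L M) R"
    and "small \<kappa> A" "small \<kappa> B" "small \<kappa> C" "indep_d L M A C B"
  shows "monotonise R A C B"
  unfolding monotonise_def
proof clarify
  fix D assume D: "C \<subseteq> D" "D \<subseteq> B \<union> C"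
  have "small \<kappa> D" by (rule small_subset[OF D(2)]) (intro small_Un assms)
  then show "R A D B"
    using assms(3-5) indep_d_base_monotone[OF assms(7) D] unfolding stronger_def by blast
qed

lemma indep_f_imp_indep_d:
  assumes "indep_f L M A C B"
  shows "indep_d L M A C B"
  unfolding indep_d_def
proof clarify
  fix \<phi> \<sigma> assume tp: "(\<phi>, \<sigma>) \<in> tp L M A id (B \<union> C)" and div: "formula_divides L M C \<phi>"
  have "formula_forks L M C \<phi>"
    unfolding formula_forks_def
    by (rule exI[of _ "{\<phi>}"]) (use tp div in \<open>auto simp: tp_def formulas_def\<close>)
  then show False using assms tp unfolding indep_f_def by blast
qed

lemma indep_f_if_extension:
  assumes \<kappa>: "Card_order \<kappa>" "natLeq <o \<kappa>" and ext: "has_extension L M \<kappa> Q"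
    and Q: "stronger \<kappa> Q (indep_d L M)"
    and small: "small \<kappa> A" "small \<kappa> B" "small \<kappa> C" and "Q A C B"
  shows "indep_f L M A C B"
  unfolding indep_f_def
proof clarify
  fix \<phi> \<sigma> assume tp: "(\<phi>, \<sigma>) \<in> tp L M A id (B \<union> C)" and "formula_forks L M C \<phi>"
  then obtain \<Psi> where \<Psi>: "finite \<Psi>" "\<Psi> \<subseteq> {\<psi> \<in> formulas L UNIV. fv \<psi> \<subseteq> fv \<phi>}"
    "\<And>\<psi>. \<psi> \<in> \<Psi> \<Longrightarrow> formula_divides L M C \<psi>" "\<And>e. holds M e \<phi> \<Longrightarrow> \<exists>\<psi>\<in>\<Psi>. holds M e \<psi>"
    unfolding formula_forks_def by blast
  define D where "D = B \<union> \<Union> (pars_fm ` \<Psi>)"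
  have D: "small \<kappa> D" "B \<subseteq> D"
    unfolding D_def using \<Psi>(1)
    by (intro small_Un[OF \<kappa> small(2)] small_finite[OF \<kappa>(2)]) (simp_all add: finite_pars_fm)
  then obtain A' where A': "set_equiv L M (B \<union> C) A' A" "Q A' C D"
    using ext small \<open>Q A C B\<close> unfolding has_extension_def by blast
  then obtain g where g: "g ` A = A'" "tp L M A g (B \<union> C) = tp L M A id (B \<union> C)"
    unfolding set_equiv_def by blast
  have "small \<kappa> A'" unfolding g(1)[symmetric] by (rule small_image[OF small(1)])
  then have d: "indep_d L M A' C D" using Q D(1) small(3) A'(2) unfolding stronger_def by blast
  have "holds M (g \<circ> \<sigma>) \<phi>" using tp unfolding g(2)[symmetric] by (simp add: tp_def)
  then obtain \<psi> where \<psi>: "\<psi> \<in> \<Psi>" "holds M (g \<circ> \<sigma>) \<psi>" using \<Psi>(4) by blast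
  have "\<sigma> ` fv \<phi> \<subseteq> A" using tp by (simp add: tp_def)
  then have "(g \<circ> \<sigma>) ` fv \<psi> \<subseteq> A'" using \<Psi>(2) \<psi>(1) g(1) by fastforce
  moreover have "\<psi> \<in> formulas L (D \<union> C)" using \<Psi>(2) \<psi>(1) by (auto simp: formulas_def D_def)
  ultimately have "(\<psi>, g \<circ> \<sigma>) \<in> tp L M A' id (D \<union> C)" using \<psi>(2) by (simp add: tp_def)
  then show False using d \<Psi>(3)[OF \<psi>(1)] unfolding indep_d_def by blast
qed

theorem corollary2p10:
  fixes L :: "('f, 'r) lang" and T :: "('f, 'r, 'm) fm set"
    and M :: "('f, 'r, 'm) struct" and \<kappa> :: "'k rel" and R :: "'m indep"
  assumes "monster_model L T M \<kappa>"
    and "invariant L M \<kappa> R"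
    and "left_monotone \<kappa> R"
    and "right_monotone \<kappa> R"
    and "stronger \<kappa> (indep_d L M) R"
    and "h_amalgamation_over_models L M \<kappa> R"
    and "has_extension L M \<kappa> (monotonise R)"
  shows "same_indep \<kappa> (monotonise R) (indep_f L M) \<and> same_indep \<kappa> (indep_f L M) (indep_d L M)"
proof -
  have \<kappa>: "Card_order \<kappa>" "natLeq <o \<kappa>" using assms(1) by (auto simp: monster_model_def)
  have md: "stronger \<kappa> (monotonise R) (indep_d L M)"
    unfolding stronger_def using monotonise_imp_indep_d[OF assms(1,2,4,6,7)] by blast
  have "monotonise R A C B = indep_f L M A C B \<and> indep_f L M A C B = indep_d L M A C B"
    if small: "small \<kappa> A" "small \<kappa> B" "small \<kappa> C" for A B C
    using indep_f_if_extension[OF \<kappa> assms(7) md small] indep_f_imp_indep_d[of L M A C B]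
      indep_d_imp_monotonise[OF \<kappa> assms(5) small] by iprover
  then show ?thesis unfolding same_indep_def by simp
qed

end
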